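(* Let $F$ be a field of characteristic zero, $k\ge2$, $L=\operatorname{Der}(M_k(F))$ and $U=\phi(U(L))\subseteq\operatorname{End}_F(M_k(F))$. Let $A$ be an $(L,U)$-algebra and $n\ge1$. (1) For every ordered pair $(\mathcal I,\mathcal J)$ of disjoint (possibly empty) sets with $\mathcal I\cup\mathcal J=\{1,\dots,n\}$, with $r:=|\mathcal I|$, and any $\boldsymbol a\in\mathcal S^{n-r}$ and $c\in\mathcal S$, there is a linear isomorphism between $P^U_{\mathcal I,\mathcal J,\boldsymbol a}$ and $P^U_{r,n-r,c}$ sending $P^U_{\mathcal I,\mathcal J,\boldsymbol a}\cap\operatorname{Id}^U(A)$ to $P^U_{r,n-r,c}\cap\operatorname{Id}^U(A)$. (2) $$c_n^U(A)=\sum_{r=0}^n\binom nr (k^2-1)^{n-r}c^U_{r,n-r}(A).$$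
   Context: $L$ is identified with $\mathrm{sl}_k(F)$ via $c\mapsto\operatorname{ad}_c$, $\operatorname{ad}_c(x)=cx-xc$; $\phi:U(L)\to\operatorname{End}_F(M_k(F))$ is the unital algebra homomorphism from the universal enveloping algebra extending this action. $e_{ij}$ are matrix units, $h_i:=e_{ii}-e_{i+1,i+1}$ ($1\le i<k$), $g:=I_k$, $\mathcal S:=\{e_{ij}\mid i\neq j\}\cup\{h_1,\dots,h_{k-1}\}$, $\mathcal M:=\mathcal S\cup\{g\}$ (a basis of $M_k(F)$). For $a,b\in\mathcal M$, $\varphi_{ab}$ is the linear endomorphism of $M_k(F)$ sending $a$ to $b$ and the other elements of $\mathcal M$ to $0$; $\{\varphi_{ab}\}_{a,b\in\mathcal S}\cup\{\varphi_{gg}\}$ is a basis of $U$. Algebras are associative, not necessarily unital. An $L$-algebra is an algebra $B$ with a Lie algebra homomorphism $L\to\operatorname{Der}(B)$, extended to a unital homomorphism $\phi_B:U(L)\to\operatorname{End}_F(B)$; $b^u:=\phi_B(u)(b)$. Exponents are multiplied in the opposite algebra. An $(L,U)$-algebra is an $L$-algebra $B$ with a right action of the unital algebra $U^{\mathrm{op}}$ (written exponentially) such that $b^u=b^{\phi(u)}$ for all $u\in U(L)$, $b\in B$; equivalently, $\ker\phi$ acts as zero on $B$. $F\langle X|U\rangle$ is the free nonunital associative algebra on the symbols $x_i^{ab}:=x_i^{\varphi_{ab}}$, $i\ge1$, ($a,b\in\mathcal S$ or $a=b=g$). $\operatorname{Id}^U(A)$ is the set of $f\in F\langle X|U\rangle$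 vanishing under all evaluations $x_i\mapsto \alpha_i\in A$, $x_i^{ab}\mapsto \alpha_i^{\varphi_{ab}}$. $P_n^U$ is the span of all multilinear monomials $x_{\sigma(1)}^{u_1}\cdots x_{\sigma(n)}^{u_n}$ ($\sigma\in S_n$, $u_1,\dots,u_n\in\{\varphi_{ab}\}_{a,b\in\mathcal S}\cup\{\varphi_{gg}\}$), and $c_n^U(A):=\dim_F P_n^U/(P_n^U\cap\operatorname{Id}^U(A))$. For an ordered pair $(\mathcal I,\mathcal J)$ of disjoint (possibly empty) sets with $\mathcal I\cup\mathcal J=\{1,\dots,n\}$ and $\boldsymbol a=(a_j)_{j\in\mathcal J}\in\mathcal S^{|\mathcal J|}$, $P^U_{\mathcal I,\mathcal J,\boldsymbol a}\subseteq P_n^U$ is the span of the multilinear monomials in $x_1,\dots,x_n$ in which each $x_i$ with $i\in\mathcal I$ appears as $x_i^{gg}$ and each $x_j$ with $j\in\mathcal J$ appears as $x_j^{a_jb}$ for some $b\in\mathcal S$. For $0\le r\le n$ and $c\in\mathcal S$, $P^U_{r,n-r,c}:=P^U_{\{1,\dots,r\},\{r+1,\dots,n\},(c,\dots,c)}$ and $c^U_{r,n-r}(A):=\dim_F P^U_{r,n-r,c}/(P^U_{r,n-r,c}\cap\operatorname{Id}^U(A))$, which is independent of $c$. *)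

theory Defs
  imports
    "HOL-Analysis.Cartesian_Space"
    "HOL-Library.Poly_Mapping"
    "HOL-Library.Function_Algebras"
    "HOL-Combinatorics.Permutations"
begin

section \<open>Free associative algebras\<close>

text \<open>
  Words form the free monoid, written additively; so \<open>'x word \<Rightarrow>\<^sub>0 'f\<close> with the convolution product
  of the library is the free unital associative algebra over the field \<open>'f\<close>.
\<close>

datatype 'x word = Word (letters: "'x list")

instantiation word :: (type) monoid_add
begin

definition zero_word :: "'a word" where
  "0 = Word []"

definition plus_word :: "'a word \<Rightarrow> 'a word \<Rightarrow> 'a word" where
  "v + w = Word (letters v @ letters w)"

instance
  by standard (simp_all add: zero_word_def plus_word_def)

end

definition fscale :: "'f::field \<Rightarrow> ('m \<Rightarrow>\<^sub>0 'f) \<Rightarrow> ('m \<Rightarrow>\<^sub>0 'f)" where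
  "fscale c p = Poly_Mapping.map ((*) c) p"

lemma lookup_fscale [simp]: "Poly_Mapping.lookup (fscale c p) w = c * Poly_Mapping.lookup p w"
  by (simp add: fscale_def Poly_Mapping.map.rep_eq when_def)

text \<open>The unital and the nonunital free algebra on a set \<open>X\<close> of symbols.\<close>

definition free_alg :: "'x set \<Rightarrow> ('x word \<Rightarrow>\<^sub>0 'f::field) set" where
  "free_alg X = {p. \<forall>w\<in>Poly_Mapping.keys p. set (letters w) \<subseteq> X}"

definition free_alg_nonunital :: "'x set \<Rightarrow> ('x word \<Rightarrow>\<^sub>0 'f::field) set" where
  "free_alg_nonunital X = {p \<in> free_alg X. Poly_Mapping.lookup p 0 = 0}"

definition monom :: "'x list \<Rightarrow> ('x word \<Rightarrow>\<^sub>0 'f::field)" where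
  "monom xs = Poly_Mapping.single (Word xs) 1"

global_interpretation free_vs: vector_space "fscale :: 'f::field \<Rightarrow> ('m \<Rightarrow>\<^sub>0 'f) \<Rightarrow> ('m \<Rightarrow>\<^sub>0 'f)"
  by standard
    (auto intro!: poly_mapping_eqI simp: algebra_simps Poly_Mapping.lookup_add)

section \<open>Quotient spaces and isomorphisms\<close>

text \<open>\<open>B\<close> consists of representatives of a basis of \<open>V / W\<close>, one for each basis element.\<close>

definition quotient_basis ::
  "('m \<Rightarrow>\<^sub>0 'f::field) set \<Rightarrow> ('m \<Rightarrow>\<^sub>0 'f) set \<Rightarrow> ('m \<Rightarrow>\<^sub>0 'f) set \<Rightarrow> bool" where
  "quotient_basis V W B \<longleftrightarrow>
     B \<subseteq> V \<and>
     (\<forall>T u. finite T \<and> T \<subseteq> B \<and> (\<Sum>b\<in>T. fscale (u b) b) \<in> W \<longrightarrow> (\<forall>b\<in>T. u b = 0)) \<and>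
     (\<forall>v\<in>V. \<exists>x\<in>free_vs.span B. v - x \<in> W)"

definition quotient_dim :: "('m \<Rightarrow>\<^sub>0 'f::field) set \<Rightarrow> ('m \<Rightarrow>\<^sub>0 'f) set \<Rightarrow> nat" where
  "quotient_dim V W = card (SOME B. quotient_basis V W B)"

text \<open>For finite-dimensional \<open>V\<close> this is the difference of the dimensions.\<close>

lemma quotient_basis_Un:
  assumes V: "free_vs.subspace V" and W: "W \<subseteq> V" and B: "quotient_basis V W B"
    and C: "free_vs.independent C" "C \<subseteq> W" "W \<subseteq> free_vs.span C" and W': "free_vs.subspace W"
  shows "free_vs.independent (B \<union> C)" "B \<inter> C = {}" "free_vs.span (B \<union> C) = V"
proof -
  have ind: "\<forall>b\<in>T. u b = 0" if "finite T" "T \<subseteq> B" "(\<Sum>b\<in>T. fscale (u b) b) \<in> W" for T u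
    using B that unfolding quotient_basis_def by blast
  show disj: "B \<inter> C = {}"
  proof (rule ccontr)
    assume "B \<inter> C \<noteq> {}"
    then obtain x where x: "x \<in> B" "x \<in> C" by blast
    with C(2) have "x \<in> W" by blast
    with x ind[of "{x}" "\<lambda>_. 1"] show False by simp
  qed
  show "free_vs.independent (B \<union> C)"
    unfolding free_vs.independent_explicit_finite_subsets
  proof (intro allI impI ballI)
    fix A u v
    assume A: "A \<subseteq> B \<union> C" "finite A" "(\<Sum>v\<in>A. fscale (u v) v) = 0" and v: "v \<in> A"
    have split: "(A \<inter> B) \<union> (A \<inter> C) = A" "(A \<inter> B) \<inter> (A \<inter> C) = {}"
      using A(1) disj by blast+
    have "finite (A \<inter> B)" "finite (A \<inter> C)" using A(2) by (rule finite_Int[OF disjI1])+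
    from sum.union_disjoint[OF this split(2), of "\<lambda>v. fscale (u v) v"]
    have "(\<Sum>v\<in>A. fscale (u v) v) =
        (\<Sum>v\<in>A\<inter>B. fscale (u v) v) + (\<Sum>v\<in>A\<inter>C. fscale (u v) v)"
      unfolding split(1) .
    then have eq: "(\<Sum>v\<in>A\<inter>B. fscale (u v) v) = - (\<Sum>v\<in>A\<inter>C. fscale (u v) v)"
      using A(3) by (simp only: eq_neg_iff_add_eq_0)
    have "(\<Sum>v\<in>A\<inter>C. fscale (u v) v) \<in> W"
      using W' C(2) by (intro free_vs.subspace_sum free_vs.subspace_scale) blast+
    then have "(\<Sum>v\<in>A\<inter>B. fscale (u v) v) \<in> W"
      unfolding eq by (rule free_vs.subspace_neg[OF W'])
    then have 1: "\<forall>b\<in>A\<inter>B. u b = 0" using ind[of "A \<inter> B" u] A(2) by blast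
    then have "(\<Sum>v\<in>A\<inter>B. fscale (u v) v) = 0"
      by (intro sum.neutral ballI) simp
    then have "(\<Sum>v\<in>A\<inter>C. fscale (u v) v) = 0" unfolding eq neg_equal_0_iff_equal .
    then have "\<forall>b\<in>A\<inter>C. u b = 0"
      using C(1)[unfolded free_vs.independent_explicit_finite_subsets]
        \<open>finite (A \<inter> C)\<close> Int_lower2 by blast
    then show "u v = 0" using 1 v A(1) by blast
  qed
  show "free_vs.span (B \<union> C) = V"
  proof
    have "B \<subseteq> V" using B unfolding quotient_basis_def by (rule conjunct1)
    then have "B \<union> C \<subseteq> V" using order_trans[OF C(2) W] by (rule Un_least)
    then show "free_vs.span (B \<union> C) \<subseteq> V" using V by (rule free_vs.span_minimal)
    show "V \<subseteq> free_vs.span (B \<union> C)"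
    proof
      fix v assume "v \<in> V"
      then obtain x where x: "x \<in> free_vs.span B" "v - x \<in> W"
        using B unfolding quotient_basis_def by blast
      have "x \<in> free_vs.span (B \<union> C)"
        using free_vs.span_mono[OF Un_upper1] x(1) by (rule subsetD)
      moreover have "v - x \<in> free_vs.span (B \<union> C)"
        using free_vs.span_mono[OF Un_upper2] subsetD[OF C(3) x(2)] by (rule subsetD)
      ultimately have "x + (v - x) \<in> free_vs.span (B \<union> C)"
        by (rule free_vs.span_add)
      then show "v \<in> free_vs.span (B \<union> C)" by (simp only: add_diff_cancel_left' diff_add_cancel add.commute[of x])
    qed
  qed
qed

lemma quotient_basis_exists:
  assumes V: "free_vs.subspace V" and W: "free_vs.subspace W" and "W \<subseteq> V"
  shows "\<exists>B. quotient_basis V W B"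
proof -
  obtain C where C: "C \<subseteq> W" "free_vs.independent C" "W \<subseteq> free_vs.span C"
    using free_vs.maximal_independent_subset by blast
  obtain D where D: "C \<subseteq> D" "D \<subseteq> V" "free_vs.independent D" "V \<subseteq> free_vs.span D"
    using free_vs.maximal_independent_subset_extend[OF order_trans[OF C(1) \<open>W \<subseteq> V\<close>] C(2)] by blast
  have spD: "free_vs.span C = W"
    using C(3) free_vs.span_minimal[OF C(1) W] by (rule subset_antisym[rotated])
  have "quotient_basis V W (D - C)"
    unfolding quotient_basis_def
  proof (intro conjI allI impI ballI)
    show "D - C \<subseteq> V" using D(2) by blast
  next
    fix T u b
    assume T: "finite T \<and> T \<subseteq> D - C \<and> (\<Sum>b\<in>T. fscale (u b) b) \<in> W" and b: "b \<in> T"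
    show "u b = 0"
    proof (rule ccontr)
      assume ub: "u b \<noteq> 0"
      let ?s = "\<Sum>b\<in>T - {b}. fscale (u b) b"
      have "(\<Sum>b\<in>T. fscale (u b) b) = fscale (u b) b + ?s"
        using T b by (intro sum.remove) blast+
      then have eq: "fscale (u b) b = (\<Sum>b\<in>T. fscale (u b) b) - ?s"
        by (simp only: add_diff_cancel_right')
      have mem: "(\<Sum>b\<in>T. fscale (u b) b) \<in> free_vs.span (D - {b})"
      proof (rule subsetD)
        show "free_vs.span C \<subseteq> free_vs.span (D - {b})"
          using T b D(1) by (intro free_vs.span_mono) blast
        show "(\<Sum>b\<in>T. fscale (u b) b) \<in> free_vs.span C" using T unfolding spD by blast
      qed
      have "?s \<in> free_vs.span (D - {b})"
        using T by (intro free_vs.span_sum free_vs.span_scale free_vs.span_base) blast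
      with mem have "fscale (u b) b \<in> free_vs.span (D - {b})"
        by (subst eq) (rule free_vs.span_diff)
      then have "fscale (inverse (u b)) (fscale (u b) b) \<in> free_vs.span (D - {b})"
        by (rule free_vs.span_scale)
      then have "b \<in> free_vs.span (D - {b})" using ub by simp
      then show False using D(3) T b unfolding free_vs.dependent_def by blast
    qed
  next
    fix v assume "v \<in> V"
    moreover have "(D - C) \<union> C = D" using D(1) by blast
    ultimately have "v \<in> free_vs.span ((D - C) \<union> C)" using D(4) by (simp only: subsetD)
    then obtain x y where "x \<in> free_vs.span (D - C)" "y \<in> free_vs.span C" "v = x + y"
      unfolding free_vs.span_Un by blast
    then show "\<exists>x\<in>free_vs.span (D - C). v - x \<in> W" using spD by (intro bexI[of _ x]) simp_all
  qed
  then show ?thesis ..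
qed

lemma quotient_dim_eq:
  assumes V: "free_vs.subspace V" and W: "free_vs.subspace W" and "W \<subseteq> V"
    and fin: "finite X" "V \<subseteq> free_vs.span X"
  shows "quotient_dim V W + free_vs.dim W = free_vs.dim V"
proof -
  obtain C where C: "C \<subseteq> W" "free_vs.independent C" "W \<subseteq> free_vs.span C" "card C = free_vs.dim W"
    using free_vs.basis_exists[of W] by blast
  define B where "B = (SOME B. quotient_basis V W B)"
  have B: "quotient_basis V W B"
    unfolding B_def using quotient_basis_exists[OF V W \<open>W \<subseteq> V\<close>] by (rule someI_ex)
  note BC = quotient_basis_Un[OF V \<open>W \<subseteq> V\<close> B C(2,1,3) W]
  have "B \<union> C \<subseteq> free_vs.span X"
    using free_vs.span_superset[of "B \<union> C"] fin(2) unfolding BC(3) by (rule order_trans)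
  then have "finite (B \<union> C)"
    using free_vs.independent_span_bound[OF fin(1) BC(1)] by blast
  then have "card (B \<union> C) = card B + card C"
    using BC(2) by (intro card_Un_disjoint) simp_all
  moreover have "free_vs.dim V = card (B \<union> C)"
    using free_vs.dim_span_eq_card_independent[OF BC(1)] unfolding BC(3) .
  moreover have "quotient_dim V W = card B"
    unfolding quotient_dim_def B_def ..
  ultimately show ?thesis by (simp only: C(4))
qed

definition linear_iso ::
  "('m \<Rightarrow>\<^sub>0 'f::field) set \<Rightarrow> ('m \<Rightarrow>\<^sub>0 'f) set \<Rightarrow> (('m \<Rightarrow>\<^sub>0 'f) \<Rightarrow> ('m \<Rightarrow>\<^sub>0 'f)) \<Rightarrow> bool" where
  "linear_iso V V' T \<longleftrightarrow>
     (\<forall>p\<in>V. \<forall>q\<in>V. T (p + q) = T p + T q) \<and>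
     (\<forall>c. \<forall>p\<in>V. T (fscale c p) = fscale c (T p)) \<and>
     bij_betw T V V'"

section \<open>Universal enveloping algebras\<close>

text \<open>
  A Lie algebra is given by its carrier \<open>L\<close>, scalar multiplication \<open>s\<close> and bracket \<open>br\<close>.
  Its universal enveloping algebra is the free unital associative algebra on the symbols
  \<open>x \<in> L\<close> modulo the two-sided ideal that makes \<open>x \<mapsto> monom [x]\<close> linear and turns the bracket
  into the commutator.
\<close>

definition ideal_generated :: "'r::ring_1 set \<Rightarrow> 'r set \<Rightarrow> 'r set" where
  "ideal_generated R G = \<Inter> {I. G \<subseteq> I \<and> I \<subseteq> R \<and> 0 \<in> I \<and> (\<forall>x\<in>I. \<forall>y\<in>I. x + y \<in> I) \<and>
      (\<forall>r\<in>R. \<forall>x\<in>I. r * x \<in> I \<and> x * r \<in> I)}"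

definition uea_relators ::
  "('f::field \<Rightarrow> 'l \<Rightarrow> 'l) \<Rightarrow> ('l \<Rightarrow> 'l \<Rightarrow> 'l) \<Rightarrow> 'l::ab_group_add set \<Rightarrow> ('l word \<Rightarrow>\<^sub>0 'f) set" where
  "uea_relators s br L =
     {monom [x + y] - monom [x] - monom [y] | x y. x \<in> L \<and> y \<in> L} \<union>
     {monom [s c x] - fscale c (monom [x]) | c x. x \<in> L} \<union>
     {monom [x] * monom [y] - monom [y] * monom [x] - monom [br x y] | x y. x \<in> L \<and> y \<in> L}"

definition uea_rel ::
  "('f::field \<Rightarrow> 'l \<Rightarrow> 'l) \<Rightarrow> ('l \<Rightarrow> 'l \<Rightarrow> 'l) \<Rightarrow> 'l::ab_group_add set \<Rightarrow> ('l word \<Rightarrow>\<^sub>0 'f) rel" where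
  "uea_rel s br L = {(p, q). p \<in> free_alg L \<and> q \<in> free_alg L \<and>
     p - q \<in> ideal_generated (free_alg L) (uea_relators s br L)}"

definition uea ::
  "('f::field \<Rightarrow> 'l \<Rightarrow> 'l) \<Rightarrow> ('l \<Rightarrow> 'l \<Rightarrow> 'l) \<Rightarrow> 'l::ab_group_add set \<Rightarrow> ('l word \<Rightarrow>\<^sub>0 'f) set set" where
  "uea s br L = free_alg L // uea_rel s br L"

text \<open>
  \<open>free_lift\<close> is the extension of an action \<open>\<delta>\<close> by linear operators to a unital homomorphism
  from the free algebra into the operators, \<open>uea_lift\<close> the induced map on the quotient.
\<close>

definition free_lift ::
  "('f::field \<Rightarrow> 'b \<Rightarrow> 'b) \<Rightarrow> ('l \<Rightarrow> 'b \<Rightarrow> 'b) \<Rightarrow> ('l word \<Rightarrow>\<^sub>0 'f) \<Rightarrow> 'b \<Rightarrow> 'b::ab_group_add" where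
  "free_lift scl \<delta> p v =
     (\<Sum>w\<in>Poly_Mapping.keys p. scl (Poly_Mapping.lookup p w) (foldr \<delta> (letters w) v))"

definition uea_lift ::
  "('f::field \<Rightarrow> 'b \<Rightarrow> 'b) \<Rightarrow> ('l \<Rightarrow> 'b \<Rightarrow> 'b) \<Rightarrow> ('l word \<Rightarrow>\<^sub>0 'f) set \<Rightarrow> 'b \<Rightarrow> 'b::ab_group_add" where
  "uea_lift scl \<delta> C = the_elem (free_lift scl \<delta> ` C)"

section \<open>Derivations and the algebra \<open>U\<close>\<close>

definition derivations ::
  "('f::field \<Rightarrow> 'b \<Rightarrow> 'b) \<Rightarrow> ('b \<Rightarrow> 'b \<Rightarrow> 'b) \<Rightarrow> ('b \<Rightarrow> 'b::ab_group_add) set" where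
  "derivations scl mul = {D. Vector_Spaces.linear scl scl D \<and>
     (\<forall>x y. D (mul x y) = mul (D x) y + mul x (D y))}"

definition opscale :: "('f \<Rightarrow> 'b \<Rightarrow> 'b) \<Rightarrow> 'f \<Rightarrow> ('b \<Rightarrow> 'b) \<Rightarrow> ('b \<Rightarrow> 'b)" where
  "opscale scl c D = (\<lambda>x. scl c (D x))"

definition commutator :: "('b \<Rightarrow> 'b) \<Rightarrow> ('b \<Rightarrow> 'b) \<Rightarrow> ('b \<Rightarrow> 'b::ab_group_add)" where
  "commutator D E = (D \<circ> E) - (E \<circ> D)"

text \<open>On every representation the induced map is independent of the representative.\<close>

lemma poly_mapping_sum_singles:
  "p = (\<Sum>w\<in>Poly_Mapping.keys p. Poly_Mapping.single w (Poly_Mapping.lookup p w))"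
proof (rule poly_mapping_eqI)
  fix k
  show "Poly_Mapping.lookup p k = Poly_Mapping.lookup
      (\<Sum>w\<in>Poly_Mapping.keys p. Poly_Mapping.single w (Poly_Mapping.lookup p w)) k"
    by (simp add: Poly_Mapping.lookup_sum Poly_Mapping.lookup_single when_def in_keys_iff)
qed

lemma free_algI: "(\<And>w. w \<in> Poly_Mapping.keys p \<Longrightarrow> set (letters w) \<subseteq> X) \<Longrightarrow> p \<in> free_alg X"
  by (simp add: free_alg_def)

lemma ideal_generated_least:
  assumes "G \<subseteq> I" "\<forall>r\<in>R. \<forall>x\<in>I. r * x \<in> I \<and> x * r \<in> I" "\<forall>x\<in>I. \<forall>y\<in>I. x + y \<in> I" "I \<subseteq> R" "0 \<in> I"
  shows "ideal_generated R G \<subseteq> I"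
  unfolding ideal_generated_def using assms by (intro Inter_lower CollectI conjI)

lemma zero_free_alg: "0 \<in> free_alg X"
  by (simp add: free_alg_def)

lemma add_free_alg: "p \<in> free_alg X \<Longrightarrow> q \<in> free_alg X \<Longrightarrow> p + q \<in> free_alg X"
  using Poly_Mapping.keys_add[of p q] unfolding free_alg_def by blast

lemma diff_free_alg: "p \<in> free_alg X \<Longrightarrow> q \<in> free_alg X \<Longrightarrow> p - q \<in> free_alg X"
  using Poly_Mapping.keys_diff[of p q] unfolding free_alg_def by blast

lemma mult_free_alg:
  assumes "p \<in> free_alg X" "q \<in> free_alg X"
  shows "p * q \<in> free_alg X"
proof (rule free_algI)
  fix w assume "w \<in> Poly_Mapping.keys (p * q)"
  then obtain u v where "w = u + v" "u \<in> Poly_Mapping.keys p" "v \<in> Poly_Mapping.keys q"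
    using Poly_Mapping.keys_mult[of p q] by blast
  then show "set (letters w) \<subseteq> X" using assms by (simp add: free_alg_def plus_word_def)
qed

lemma monom_free_alg: "set xs \<subseteq> X \<Longrightarrow> monom xs \<in> free_alg X"
  by (simp add: free_alg_def monom_def)

lemma fscale_free_alg: "p \<in> free_alg X \<Longrightarrow> fscale c p \<in> free_alg X"
  by (simp add: free_alg_def in_keys_iff)

context
  fixes scl :: "'f::field \<Rightarrow> 'b::ab_group_add \<Rightarrow> 'b" and \<delta> :: "'l::ab_group_add \<Rightarrow> 'b \<Rightarrow> 'b"
    and s :: "'f \<Rightarrow> 'l \<Rightarrow> 'l" and br :: "'l \<Rightarrow> 'l \<Rightarrow> 'l" and L :: "'l set"
  assumes vs: "vector_space scl"
    and linear: "x \<in> L \<Longrightarrow> Vector_Spaces.linear scl scl (\<delta> x)"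
begin

interpretation V: vector_space scl by (rule vs)

lemma free_lift_superset:
  assumes "finite T" "Poly_Mapping.keys p \<subseteq> T"
  shows "free_lift scl \<delta> p v = (\<Sum>w\<in>T. scl (Poly_Mapping.lookup p w) (foldr \<delta> (letters w) v))"
  unfolding free_lift_def using assms
  by (intro sum.mono_neutral_left) (auto simp: in_keys_iff)

lemma free_lift_add: "free_lift scl \<delta> (p + q) = free_lift scl \<delta> p + free_lift scl \<delta> q"
proof
  fix v
  let ?T = "Poly_Mapping.keys p \<union> Poly_Mapping.keys q"
  show "free_lift scl \<delta> (p + q) v = (free_lift scl \<delta> p + free_lift scl \<delta> q) v"
    using Poly_Mapping.keys_add[of p q]
    by (simp add: free_lift_superset[of ?T] lookup_add V.scale_left_distrib sum.distrib)
qed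

lemma free_lift_fscale: "free_lift scl \<delta> (fscale c p) = opscale scl c (free_lift scl \<delta> p)"
proof
  fix v
  have "Poly_Mapping.keys (fscale c p) \<subseteq> Poly_Mapping.keys p" by (auto simp: in_keys_iff)
  then show "free_lift scl \<delta> (fscale c p) v = opscale scl c (free_lift scl \<delta> p) v"
    by (simp add: free_lift_superset[of "Poly_Mapping.keys p"] opscale_def V.scale_sum_right)
qed

lemma free_lift_zero: "free_lift scl \<delta> 0 = 0"
  by (auto simp: free_lift_def)

lemma free_lift_diff: "free_lift scl \<delta> (p - q) = free_lift scl \<delta> p - free_lift scl \<delta> q"
  using free_lift_add[of "p - q" q] by (simp add: algebra_simps)

lemma free_lift_sum: "free_lift scl \<delta> (sum f A) = (\<Sum>a\<in>A. free_lift scl \<delta> (f a))"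
  by (induction A rule: infinite_finite_induct) (auto simp: free_lift_add free_lift_zero)

lemma free_lift_single:
  "free_lift scl \<delta> (Poly_Mapping.single w c) v = scl c (foldr \<delta> (letters w) v)"
  by (simp add: free_lift_superset[of "{w}"] lookup_single)

lemma free_lift_monom: "free_lift scl \<delta> (monom xs) = foldr \<delta> xs"
  by (auto simp: monom_def free_lift_single)

lemma foldr_linear: "set xs \<subseteq> L \<Longrightarrow> Vector_Spaces.linear scl scl (foldr \<delta> xs)"
proof (induction xs)
  case Nil then show ?case using V.linear_id by (simp add: id_def)
next
  case (Cons x xs)
  then have "Vector_Spaces.linear scl scl (\<delta> x \<circ> foldr \<delta> xs)"
    by (intro Vector_Spaces.linear_compose) (auto intro: linear)
  then show ?case by (simp add: comp_def)
qed

lemma fun_sum_apply: "(sum f A) x = (\<Sum>a\<in>A. f a x)" for f :: "'c \<Rightarrow> 'd \<Rightarrow> 'e::comm_monoid_add"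
  by (induction A rule: infinite_finite_induct) auto

lemma free_lift_mult:
  assumes "p \<in> free_alg L"
  shows "free_lift scl \<delta> (p * q) = free_lift scl \<delta> p \<circ> free_lift scl \<delta> q"
proof
  fix x
  let ?l = Poly_Mapping.lookup and ?k = Poly_Mapping.keys
  have "p * q = (\<Sum>v\<in>?k p. \<Sum>w\<in>?k q. Poly_Mapping.single (v + w) (?l p v * ?l q w))"
    unfolding mult_single[symmetric] sum_product[symmetric]
    using poly_mapping_sum_singles[of p] poly_mapping_sum_singles[of q] by simp
  then have "free_lift scl \<delta> (p * q) x =
      (\<Sum>v\<in>?k p. \<Sum>w\<in>?k q. scl (?l p v * ?l q w) (foldr \<delta> (letters (v + w)) x))"
    by (simp add: free_lift_sum fun_sum_apply free_lift_single)
  also have "\<dots> = (\<Sum>v\<in>?k p. scl (?l p v) (foldr \<delta> (letters v) (free_lift scl \<delta> q x)))"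
  proof (rule sum.cong[OF refl])
    fix v assume "v \<in> ?k p"
    then interpret Vector_Spaces.linear scl scl "foldr \<delta> (letters v)"
      using assms by (intro foldr_linear) (auto simp: free_alg_def)
    show "(\<Sum>w\<in>?k q. scl (?l p v * ?l q w) (foldr \<delta> (letters (v + w)) x)) =
       scl (?l p v) (foldr \<delta> (letters v) (free_lift scl \<delta> q x))"
      by (simp add: free_lift_def sum scale V.scale_sum_right plus_word_def)
  qed
  finally show "free_lift scl \<delta> (p * q) x = (free_lift scl \<delta> p \<circ> free_lift scl \<delta> q) x"
    by (simp add: free_lift_def)
qed

lemma free_lift_linear:
  assumes "p \<in> free_alg L"
  shows "Vector_Spaces.linear scl scl (free_lift scl \<delta> p)"
proof -
  have lin: "Vector_Spaces.linear scl scl (foldr \<delta> (letters w))" if "w \<in> Poly_Mapping.keys p" for w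
    using assms that by (intro foldr_linear) (auto simp: free_alg_def)
  show ?thesis
    unfolding Vector_Spaces.linear_iff free_lift_def
    using lin vs
    by (auto simp: Vector_Spaces.linear_iff V.scale_right_distrib sum.distrib V.scale_sum_right
        mult.commute intro!: sum.cong)
qed

context
  assumes add: "x \<in> L \<Longrightarrow> y \<in> L \<Longrightarrow> \<delta> (x + y) = \<delta> x + \<delta> y"
    and scale: "x \<in> L \<Longrightarrow> \<delta> (s c x) = opscale scl c (\<delta> x)"
    and bracket: "x \<in> L \<Longrightarrow> y \<in> L \<Longrightarrow> \<delta> (br x y) = commutator (\<delta> x) (\<delta> y)"
    and closed: "x \<in> L \<Longrightarrow> y \<in> L \<Longrightarrow> x + y \<in> L" "x \<in> L \<Longrightarrow> s c x \<in> L"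
      "x \<in> L \<Longrightarrow> y \<in> L \<Longrightarrow> br x y \<in> L"
begin

lemma free_lift_ideal:
  assumes "r \<in> ideal_generated (free_alg L) (uea_relators s br L)"
  shows "free_lift scl \<delta> r = 0"
proof -
  let ?K = "{p \<in> free_alg L. free_lift scl \<delta> p = 0}"
  have lin0: "free_lift scl \<delta> p 0 = 0" if "p \<in> free_alg L" for p
    using Vector_Spaces.linear_iff free_lift_linear[OF that]
    by (metis V.scale_zero_left)
  have "monom [x + y] - monom [x] - monom [y] \<in> ?K" if "x \<in> L" "y \<in> L" for x y
    using that closed
    by (simp add: diff_free_alg monom_free_alg free_lift_diff free_lift_monom add comp_def
        plus_fun_def fun_diff_def zero_fun_def)
  moreover have "monom [s c x] - fscale c (monom [x]) \<in> ?K" if "x \<in> L" for c x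
    using that closed
    by (simp add: diff_free_alg monom_free_alg fscale_free_alg free_lift_diff free_lift_monom free_lift_fscale scale comp_def)
  moreover have "monom [x] * monom [y] - monom [y] * monom [x] - monom [br x y] \<in> ?K"
    if "x \<in> L" "y \<in> L" for x y
    using that closed
    by (simp add: diff_free_alg mult_free_alg monom_free_alg free_lift_diff free_lift_monom free_lift_mult[OF monom_free_alg] bracket
          commutator_def)
  ultimately have "uea_relators s br L \<subseteq> ?K"
    unfolding uea_relators_def by blast
  moreover have "\<forall>r\<in>free_alg L. \<forall>x\<in>?K. r * x \<in> ?K \<and> x * r \<in> ?K"
    by (simp add: mult_free_alg free_lift_mult lin0 comp_def zero_fun_def)
  moreover have "\<forall>p\<in>?K. \<forall>q\<in>?K. p + q \<in> ?K"
    by (simp add: add_free_alg free_lift_add)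
  moreover have "?K \<subseteq> free_alg L" "0 \<in> ?K"
    by (simp_all add: zero_free_alg free_lift_zero Collect_restrict)
  ultimately have "ideal_generated (free_alg L) (uea_relators s br L) \<subseteq> ?K"
    by (intro ideal_generated_least)
  with assms have "r \<in> ?K" by (rule rev_subsetD)
  then show ?thesis by simp
qed

lemma uea_lift_class:
  assumes "p \<in> free_alg L"
  shows "uea_lift scl \<delta> (uea_rel s br L `` {p}) = free_lift scl \<delta> p"
proof -
  have "free_lift scl \<delta> q = free_lift scl \<delta> p" if "(p, q) \<in> uea_rel s br L" for q
  proof -
    have "free_lift scl \<delta> (p - q) = 0"
      using that free_lift_ideal unfolding uea_rel_def by blast
    then show ?thesis by (simp add: free_lift_diff)
  qed
  then have "free_lift scl \<delta> ` (uea_rel s br L `` {p}) =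
      (\<lambda>_. free_lift scl \<delta> p) ` (uea_rel s br L `` {p})"
    by (intro image_cong) simp_all
  moreover have "p \<in> uea_rel s br L `` {p}"
    using assms unfolding uea_rel_def ideal_generated_def by simp
  ultimately have "free_lift scl \<delta> ` (uea_rel s br L `` {p}) = {free_lift scl \<delta> p}"
    by (metis image_constant)
  then show ?thesis by (simp only: uea_lift_def the_elem_eq)
qed

end
end

text \<open>Square matrices carry the product \<^term>\<open>(**)\<close>; \<^term>\<open>(*)\<close> on them is componentwise.\<close>

type_synonym ('f, 'k) mat = "'f ^ 'k ^ 'k"

definition mscale :: "'f::field \<Rightarrow> ('f, 'k::finite) mat \<Rightarrow> ('f, 'k) mat" where
  "mscale c A = (\<chi> i j. c * A $ i $ j)"

lemma vector_space_mscale: "vector_space (mscale :: 'f::field \<Rightarrow> ('f, 'k::finite) mat \<Rightarrow> ('f, 'k) mat)"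
  by standard (auto simp: mscale_def vec_eq_iff algebra_simps)

definition matrix_der :: "(('f::field, 'k::finite) mat \<Rightarrow> ('f, 'k) mat) set" where
  "matrix_der = derivations mscale (**)"

lemma derivations_closed:
  assumes mul: "\<And>x y z. mul (x + y) z = mul x z + mul y z" "\<And>x y z. mul x (y + z) = mul x y + mul x z"
    "\<And>c x y. mul (scl c x) y = scl c (mul x y)" "\<And>c x y. mul x (scl c y) = scl c (mul x y)"
    and D: "D \<in> derivations scl mul" and E: "E \<in> derivations scl mul"
  shows "D + E \<in> derivations scl mul" "opscale scl c D \<in> derivations scl mul"
    "commutator D E \<in> derivations scl mul"
proof -
  interpret V: vector_space scl
    using D by (simp add: derivations_def Vector_Spaces.linear_iff)
  have lin: "D (x + y) = D x + D y" "E (x + y) = E x + E y" "D (scl c x) = scl c (D x)"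
    "E (scl c x) = scl c (E x)" "D (mul x y) = mul (D x) y + mul x (D y)"
    "E (mul x y) = mul (E x) y + mul x (E y)" for x y c
    using D E by (simp_all add: derivations_def Vector_Spaces.linear_iff)
  have mul_diff: "mul (x - y) z = mul x z - mul y z" "mul z (x - y) = mul z x - mul z y" for x y z
    using mul(1)[of "x - y" y z] mul(2)[of z "x - y" y] by simp_all
  show "D + E \<in> derivations scl mul"
    by (simp add: derivations_def Vector_Spaces.linear_iff V.vector_space_axioms lin mul
        V.scale_right_distrib)
  show "opscale scl c D \<in> derivations scl mul"
    by (simp add: derivations_def Vector_Spaces.linear_iff V.vector_space_axioms lin mul opscale_def
        V.scale_right_distrib mult.commute)
  show "commutator D E \<in> derivations scl mul"
    by (simp add: derivations_def Vector_Spaces.linear_iff V.vector_space_axioms lin mul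
        commutator_def mul_diff V.scale_right_diff_distrib)
qed

lemma matrix_der_closed:
  fixes D E :: "('f::field, 'k::finite) mat \<Rightarrow> ('f, 'k) mat"
  assumes "D \<in> matrix_der" "E \<in> matrix_der"
  shows "D + E \<in> matrix_der" "opscale mscale c D \<in> matrix_der" "commutator D E \<in> matrix_der"
proof -
  have 1: "mscale c A ** B = mscale c (A ** B)" "A ** mscale c B = mscale c (A ** B)"
    for c and A B :: "('f, 'k) mat"
    by (simp_all add: mscale_def matrix_matrix_mult_def vec_eq_iff sum_distrib_left mult_ac)
  have 2: "(A + B) ** C = A ** C + B ** C" "A ** (B + C) = A ** B + A ** C"
    for A B C :: "('f, 'k) mat"
    by (simp_all add: matrix_matrix_mult_def vec_eq_iff sum.distrib algebra_simps)
  show "D + E \<in> matrix_der" "opscale mscale c D \<in> matrix_der" "commutator D E \<in> matrix_der"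
    using derivations_closed[of "(**)" mscale D E] 1 2 assms
    unfolding matrix_der_def by blast+
qed

definition U_der :: "((('f::field, 'k::finite) mat \<Rightarrow> ('f, 'k) mat) word \<Rightarrow>\<^sub>0 'f) set set" where
  "U_der = uea (opscale mscale) commutator matrix_der"

definition phi ::
  "((('f::field, 'k::finite) mat \<Rightarrow> ('f, 'k) mat) word \<Rightarrow>\<^sub>0 'f) set \<Rightarrow> ('f, 'k) mat \<Rightarrow> ('f, 'k) mat" where
  "phi = uea_lift mscale (\<lambda>D. D)"

lemma phi_class:
  assumes "p \<in> free_alg matrix_der"
  shows "phi (uea_rel (opscale mscale) commutator matrix_der `` {p}) = free_lift mscale (\<lambda>D. D) p"
  unfolding phi_def
  by (rule uea_lift_class[OF vector_space_mscale])
    (simp_all add: assms matrix_der_closed, simp add: matrix_der_def derivations_def)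

definition U_alg :: "(('f::field, 'k::finite) mat \<Rightarrow> ('f, 'k) mat) set" where
  "U_alg = phi ` U_der"

section \<open>Algebras with actions of \<open>L\<close> and \<open>U\<close>\<close>

locale assoc_algebra = vector_space scl
  for scl :: "'f::field \<Rightarrow> 'a::ring \<Rightarrow> 'a" +
  assumes scale_mult_left: "scl c x * y = scl c (x * y)"
    and scale_mult_right: "x * scl c y = scl c (x * y)"

locale L_algebra = assoc_algebra scl
  for scl :: "'f::field \<Rightarrow> 'a::ring \<Rightarrow> 'a" +
  fixes \<delta> :: "(('f, 'k::finite) mat \<Rightarrow> ('f, 'k) mat) \<Rightarrow> 'a \<Rightarrow> 'a"
  assumes \<delta>_derivation: "D \<in> matrix_der \<Longrightarrow> \<delta> D \<in> derivations scl (*)"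
    and \<delta>_add: "D \<in> matrix_der \<Longrightarrow> E \<in> matrix_der \<Longrightarrow> \<delta> (D + E) = \<delta> D + \<delta> E"
    and \<delta>_scale: "D \<in> matrix_der \<Longrightarrow> \<delta> (opscale mscale c D) = opscale scl c (\<delta> D)"
    and \<delta>_commutator: "D \<in> matrix_der \<Longrightarrow> E \<in> matrix_der \<Longrightarrow>
      \<delta> (commutator D E) = commutator (\<delta> D) (\<delta> E)"

text \<open>
  \<open>act u b\<close> stands for the power of \<open>b\<close> with exponent \<open>u\<close>. A right action of the opposite of
  \<^const>\<open>U_alg\<close> takes first \<open>u\<close> and then \<open>v\<close> to the product of \<open>u\<close> and \<open>v\<close> in the opposite
  algebra, which is \<^term>\<open>v \<circ> u\<close>.
\<close>

locale LU_algebra = L_algebra scl \<delta>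
  for scl :: "'f::field \<Rightarrow> 'a::ring \<Rightarrow> 'a"
    and \<delta> :: "(('f, 'k::finite) mat \<Rightarrow> ('f, 'k) mat) \<Rightarrow> 'a \<Rightarrow> 'a" +
  fixes act :: "(('f, 'k) mat \<Rightarrow> ('f, 'k) mat) \<Rightarrow> 'a \<Rightarrow> 'a"
  assumes act_linear: "u \<in> U_alg \<Longrightarrow> Vector_Spaces.linear scl scl (act u)"
    and act_add: "u \<in> U_alg \<Longrightarrow> v \<in> U_alg \<Longrightarrow> act (u + v) b = act u b + act v b"
    and act_scale: "u \<in> U_alg \<Longrightarrow> act (opscale mscale c u) b = scl c (act u b)"
    and act_id: "act id b = b"
    and act_comp: "u \<in> U_alg \<Longrightarrow> v \<in> U_alg \<Longrightarrow> act (v \<circ> u) b = act v (act u b)"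
    and act_compatible: "\<xi> \<in> U_der \<Longrightarrow> uea_lift scl \<delta> \<xi> b = act (phi \<xi>) b"

section \<open>The basis of the matrix algebra\<close>

text \<open>The index set \<open>1, ..., k\<close> is rendered as a finite linear order.\<close>

definition mat_unit :: "'k \<Rightarrow> 'k \<Rightarrow> ('f::field, 'k::finite) mat" where
  "mat_unit i j = (\<chi> r s. if r = i \<and> s = j then 1 else 0)"

definition next_index :: "'k::{finite,linorder} \<Rightarrow> 'k" where
  "next_index i = Min {j. i < j}"

definition h_mat :: "'k::{finite,linorder} \<Rightarrow> ('f::field, 'k) mat" where
  "h_mat i = mat_unit i i - mat_unit (next_index i) (next_index i)"

definition S_basis :: "('f::field, 'k::{finite,linorder}) mat set" where
  "S_basis = {mat_unit i j | i j. i \<noteq> j} \<union> {h_mat i | i. \<exists>j. i < j}"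

definition g_mat :: "('f::field, 'k::finite) mat" where
  "g_mat = Finite_Cartesian_Product.mat 1"

definition M_basis :: "('f::field, 'k::{finite,linorder}) mat set" where
  "M_basis = insert g_mat S_basis"

definition elem_map ::
  "('f::field, 'k::{finite,linorder}) mat \<Rightarrow> ('f, 'k) mat \<Rightarrow> ('f, 'k) mat \<Rightarrow> ('f, 'k) mat" where
  "elem_map a b = (THE f. Vector_Spaces.linear mscale mscale f \<and> f a = b \<and>
     (\<forall>c\<in>M_basis - {a}. f c = 0))"

section \<open>\<open>U\<close>-polynomials, identities and codimensions\<close>

text \<open>The pair \<open>(a, b)\<close> stands for the exponent \<^term>\<open>elem_map a b\<close>.\<close>

definition exponents :: "(('f::field, 'k::{finite,linorder}) mat \<times> ('f, 'k) mat) set" where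
  "exponents = S_basis \<times> S_basis \<union> {(g_mat, g_mat)}"

type_synonym ('f, 'k) symb = "nat \<times> ('f, 'k) mat \<times> ('f, 'k) mat"

definition symbols :: "('f::field, 'k::{finite,linorder}) symb set" where
  "symbols = {1..} \<times> exponents"

text \<open>Evaluation in a possibly nonunital algebra; the value at the empty word is irrelevant.\<close>

fun eval_word :: "('x \<Rightarrow> 'a::ring) \<Rightarrow> 'x list \<Rightarrow> 'a" where
  "eval_word \<rho> [] = 0"
| "eval_word \<rho> [x] = \<rho> x"
| "eval_word \<rho> (x # y # xs) = \<rho> x * eval_word \<rho> (y # xs)"

definition eval_free ::
  "('f::field \<Rightarrow> 'a \<Rightarrow> 'a) \<Rightarrow> ('x \<Rightarrow> 'a) \<Rightarrow> ('x word \<Rightarrow>\<^sub>0 'f) \<Rightarrow> 'a::ring" where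
  "eval_free scl \<rho> f =
     (\<Sum>w\<in>Poly_Mapping.keys f. scl (Poly_Mapping.lookup f w) (eval_word \<rho> (letters w)))"

definition Id_U ::
  "('f::field \<Rightarrow> 'a \<Rightarrow> 'a::ring) \<Rightarrow> ((('f, 'k::{finite,linorder}) mat \<Rightarrow> ('f, 'k) mat) \<Rightarrow> 'a \<Rightarrow> 'a)
    \<Rightarrow> (('f, 'k) symb word \<Rightarrow>\<^sub>0 'f) set" where
  "Id_U scl act = {f \<in> free_alg_nonunital symbols.
     \<forall>\<alpha>. eval_free scl (\<lambda>(i, a, b). act (elem_map a b) (\<alpha> i)) f = 0}"

definition multilinear_monomial ::
  "nat \<Rightarrow> (nat \<Rightarrow> nat) \<Rightarrow> (nat \<Rightarrow> ('f::field, 'k::finite) mat \<times> ('f, 'k) mat)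
    \<Rightarrow> (('f, 'k) symb word \<Rightarrow>\<^sub>0 'f)" where
  "multilinear_monomial n \<sigma> u = monom (map (\<lambda>m. (\<sigma> m, u m)) [1..<Suc n])"

definition P_U :: "nat \<Rightarrow> (('f::field, 'k::{finite,linorder}) symb word \<Rightarrow>\<^sub>0 'f) set" where
  "P_U n = free_vs.span {multilinear_monomial n \<sigma> u | \<sigma> u.
     \<sigma> permutes {1..n} \<and> (\<forall>m\<in>{1..n}. u m \<in> exponents)}"

definition P_U_split ::
  "nat \<Rightarrow> nat set \<Rightarrow> nat set \<Rightarrow> (nat \<Rightarrow> ('f::field, 'k::{finite,linorder}) mat)
    \<Rightarrow> (('f, 'k) symb word \<Rightarrow>\<^sub>0 'f) set" where
  "P_U_split n I J a = free_vs.span {multilinear_monomial n \<sigma> u | \<sigma> u.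
     \<sigma> permutes {1..n} \<and>
     (\<forall>m\<in>{1..n}. (\<sigma> m \<in> I \<longrightarrow> u m = (g_mat, g_mat)) \<and>
                 (\<sigma> m \<in> J \<longrightarrow> (\<exists>b\<in>S_basis. u m = (a (\<sigma> m), b))))}"

definition P_U_std ::
  "nat \<Rightarrow> nat \<Rightarrow> ('f::field, 'k::{finite,linorder}) mat \<Rightarrow> (('f, 'k) symb word \<Rightarrow>\<^sub>0 'f) set" where
  "P_U_std n r c = P_U_split n {1..r} {r+1..n} (\<lambda>_. c)"

definition codim_U ::
  "('f::field \<Rightarrow> 'a \<Rightarrow> 'a::ring) \<Rightarrow> ((('f, 'k::{finite,linorder}) mat \<Rightarrow> ('f, 'k) mat) \<Rightarrow> 'a \<Rightarrow> 'a)
    \<Rightarrow> nat \<Rightarrow> nat" where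
  "codim_U scl act n = quotient_dim (P_U n) (P_U n \<inter> Id_U scl act)"

definition codim_U_std ::
  "('f::field \<Rightarrow> 'a \<Rightarrow> 'a::ring) \<Rightarrow> ((('f, 'k::{finite,linorder}) mat \<Rightarrow> ('f, 'k) mat) \<Rightarrow> 'a \<Rightarrow> 'a)
    \<Rightarrow> nat \<Rightarrow> nat \<Rightarrow> ('f, 'k) mat \<Rightarrow> nat" where
  "codim_U_std scl act n r c =
     quotient_dim (P_U_std n r c) (P_U_std n r c \<inter> Id_U scl act)"

end

theory Submission
  imports Defs
begin

text \<open>
  Write \<open>\<phi>\<^sub>a\<^sub>b\<close> for \<open>elem_map a b\<close>, and call \<open>a\<close> the source of the exponent. These maps multiply like
  matrix units: \<open>\<phi>\<^sub>b\<^sub>d \<circ> \<phi>\<^sub>a\<^sub>b = \<phi>\<^sub>a\<^sub>d\<close>, and \<open>\<phi>\<^sub>b\<^sub>d \<circ> \<phi>\<^sub>a\<^sub>c = 0\<close> for \<open>b \<noteq> c\<close>. As soon as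
  those with \<open>a\<close>, \<open>b\<close> both traceless basis elements or both equal to \<open>g\<close> act on the algebra, both parts of the theorem are substitutions.

  For the isomorphism, rename the variables by a bijection and change the source \<open>a\<^sub>j\<close> of each
  exponent to \<open>c\<close>. Evaluating the renamed polynomial at \<open>\<alpha>\<close> amounts to evaluating the original
  one after applying \<open>\<phi>\<close> with source \<open>c\<close> and target \<open>a\<^sub>j\<close> to the elements, so identities go to
  identities (\<open>sub_letters_recolour\<close>), and the inverse renaming has the same form
  (\<open>component_iso\<close>).

  For the codimension formula, each multilinear monomial belongs to exactly one of the spaces
  indexed by a set \<open>I\<close> and a family \<open>a\<close> on its complement. Applying the idempotents \<open>\<phi>\<^sub>g\<^sub>g\<close> and
  \<open>\<phi>\<close> with source and target \<open>a\<^sub>j\<close> to the elements turns evaluation of a polynomial into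
  evaluation of its component at \<open>(I, a)\<close>, so the identities form the direct sum of their
  components (\<open>coord_proj_Id_U\<close>), and codimensions add up (\<open>quotient_dim_eq_sum\<close>). By the first
  part the summand depends only on the size \<open>r\<close> of \<open>I\<close>. There are \<open>n choose r\<close> such sets, each
  with \<open>(k\<^sup>2 - 1)\<close> to the power \<open>n - r\<close> families, as the traceless basis has \<open>k\<^sup>2 - 1\<close> elements
  (\<open>card_S_basis\<close>).

  It remains to see that these maps \<open>\<phi>\<^sub>a\<^sub>b\<close> lie in \<open>U\<close> (\<open>elem_map_in_U_alg\<close>); this is a case of the
  density theorem, but an explicit computation is enough. For an off-diagonal matrix unit \<open>e\<close> the
  square of \<open>ad e\<close> is \<open>x \<mapsto> - 2 e x e\<close>, an operator of rank one. Composing it with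
  inner derivations on both sides yields all operators \<open>x \<mapsto> f(x) v\<close> with \<open>v\<close> traceless and \<open>f\<close> a
  functional that vanishes on the identity matrix, and \<open>\<phi>\<^sub>g\<^sub>g\<close> is the identity minus all
  \<open>\<phi>\<^sub>a\<^sub>a\<close> with traceless \<open>a\<close>.
\<close>

section \<open>The basis of the matrix algebra\<close>

lemma mat_unit_mult_nth:
  "(mat_unit i j ** A) $ r $ s = (if r = i then A $ j $ s else 0)"
  "(A ** mat_unit i j) $ r $ s = (if s = j then A $ r $ i else 0)"
  for A :: "('f::field, 'k::finite) mat"
  by (simp_all add: mat_unit_def matrix_matrix_mult_def if_distrib[of "\<lambda>x. x * _"]
      if_distrib[of "\<lambda>x. _ * x"] cong: if_cong)

lemma mat_unit_nth: "mat_unit i j $ r $ s = (if r = i \<and> s = j then 1 else 0)"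
  by (simp add: mat_unit_def)

lemma mscale_nth [simp]: "mscale c A $ i $ j = c * A $ i $ j"
  by (simp add: mscale_def)

lemma mat_unit_inject:
  "(mat_unit i j :: ('f::field, 'k::finite) mat) = mat_unit i' j' \<longleftrightarrow> i = i' \<and> j = j'"
proof
  assume "(mat_unit i j :: ('f, 'k) mat) = mat_unit i' j'"
  then have "(mat_unit i j :: ('f, 'k) mat) $ i $ j = mat_unit i' j' $ i $ j" by (rule arg_cong)
  then show "i = i' \<and> j = j'" by (simp add: mat_unit_nth split: if_splits)
qed simp

lemma sum_mat_units:
  "A = (\<Sum>(i, j)\<in>UNIV. mscale (A $ i $ j) (mat_unit i j))" for A :: "('f::field, 'k::finite) mat"
proof -
  have "(\<Sum>x\<in>UNIV. (case x of (i, j) \<Rightarrow> mscale (A $ i $ j) (mat_unit i j)) $ r $ s) = A $ r $ s" for r s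
  proof -
    have "(\<Sum>x\<in>UNIV. (case x of (i, j) \<Rightarrow> mscale (A $ i $ j) (mat_unit i j)) $ r $ s) =
        (\<Sum>x\<in>UNIV. if x = (r, s) then A $ r $ s else 0)"
      by (intro sum.cong) (auto simp: mat_unit_nth split: if_splits)
    then show ?thesis by simp
  qed
  then show ?thesis by (simp add: vec_eq_iff)
qed

text \<open>
  The standard basis serves to compute the dimension \<open>k\<^sup>2\<close>, against which the size of \<open>M_basis\<close>
  is measured.
\<close>

definition mat_units :: "('f::field, 'k::finite) mat set" where
  "mat_units = range (\<lambda>(i, j). mat_unit i j)"

lemma inj_mat_unit: "inj (\<lambda>(i, j). mat_unit i j :: ('f::field, 'k::finite) mat)"
  by (auto intro!: injI simp: mat_unit_inject)

global_interpretation mat_vs: finite_dimensional_vector_space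
  "mscale :: 'f::field \<Rightarrow> ('f, 'k::finite) mat \<Rightarrow> ('f, 'k) mat" mat_units
proof -
  interpret vector_space "mscale :: 'f \<Rightarrow> ('f, 'k) mat \<Rightarrow> ('f, 'k) mat"
    by (rule vector_space_mscale)
  have "u v = 0" if u: "(\<Sum>v\<in>mat_units. mscale (u v) v) = 0" and v: "v \<in> mat_units"
    for u and v :: "('f, 'k) mat"
  proof -
    obtain i j where ij: "v = mat_unit i j" using v by (auto simp: mat_units_def)
    have "(\<Sum>v\<in>mat_units. mscale (u v) v) =
        (\<Sum>(i, j)\<in>UNIV. mscale (u (mat_unit i j)) (mat_unit i j))"
      unfolding mat_units_def by (subst sum.reindex[OF inj_mat_unit]) (simp add: case_prod_unfold)
    also have "\<dots> $ i $ j = (\<Sum>x\<in>UNIV. if x = (i, j) then u (mat_unit i j) else 0)"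
      unfolding sum_component by (intro sum.cong) (auto simp: mat_unit_nth split: if_splits)
    finally show ?thesis using u ij by simp
  qed
  moreover have "mat_unit i j \<in> mat_units" for i j
    unfolding mat_units_def by (rule range_eqI[of _ _ "(i, j)"]) simp
  then have "A \<in> span mat_units" for A
    by (subst sum_mat_units, intro span_sum) (auto intro: span_scale span_base)
  moreover have "finite (mat_units :: ('f, 'k) mat set)" by (simp add: mat_units_def)
  ultimately show "finite_dimensional_vector_space
      (mscale :: 'f \<Rightarrow> ('f, 'k) mat \<Rightarrow> ('f, 'k) mat) mat_units"
    by unfold_locales (auto simp: dependent_finite)
qed

lemma dim_matrices: "mat_vs.dim (UNIV :: ('f::field, 'k::finite) mat set) = CARD('k)\<^sup>2"
proof -
  have "mat_vs.dim (UNIV :: ('f, 'k) mat set) = card (mat_units :: ('f, 'k) mat set)"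
    by (metis mat_vs.dim_eq_card mat_vs.independent_Basis mat_vs.span_Basis mat_vs.span_UNIV)
  also have "\<dots> = CARD('k \<times> 'k)"
    unfolding mat_units_def by (rule card_image[OF inj_mat_unit])
  finally show ?thesis by (simp add: power2_eq_square)
qed

lemma next_index_greater:
  fixes i :: "'k::{finite,linorder}"
  assumes "i < j" shows "i < next_index i" "next_index i \<le> j"
proof -
  have "next_index i \<in> {j. i < j}"
    unfolding next_index_def using assms by (intro Min_in) auto
  then show "i < next_index i" by simp
  show "next_index i \<le> j" using assms by (simp add: next_index_def)
qed

lemma finite_S_basis: "finite (S_basis :: ('f::field, 'k::{finite,linorder}) mat set)"
proof -
  have S: "(S_basis :: ('f, 'k) mat set) = (\<lambda>(i, j). mat_unit i j) ` {(i, j). i \<noteq> j} \<union> h_mat ` {i::'k. \<exists>j. i < j}"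
    by (auto simp: S_basis_def)
  show ?thesis unfolding S by simp
qed

text \<open>
  Counting the indices gives only an upper bound, as different indices might give the same
  matrix. Once \<open>M_basis\<close> is known to span a space of dimension \<open>k\<^sup>2\<close>, the bound is sharp.
\<close>

lemma card_S_basis_le:
  "Suc (card (S_basis :: ('f::field, 'k::{finite,linorder}) mat set)) \<le> CARD('k)\<^sup>2"
proof -
  let ?D = "(\<lambda>i::'k. (i, i)) ` UNIV"
  have off: "{(i::'k, j). i \<noteq> j} = UNIV - ?D" by auto
  have "card {(i::'k, j). i \<noteq> j} = CARD('k)\<^sup>2 - CARD('k)"
    unfolding off by (subst card_Diff_subset) (auto simp: card_image inj_on_def power2_eq_square)
  then have 1: "card ((\<lambda>(i, j). mat_unit i j :: ('f, 'k) mat) ` {(i, j). i \<noteq> j}) \<le> CARD('k)\<^sup>2 - CARD('k)"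
    by (metis card_image_le finite_code)
  have "{i::'k. \<exists>j. i < j} \<subseteq> UNIV - {Max UNIV}" by (auto simp: not_less)
  then have "card {i::'k. \<exists>j. i < j} \<le> CARD('k) - 1"
    by (metis card_Diff_singleton card_mono finite_code UNIV_I)
  then have 2: "card (h_mat ` {i::'k. \<exists>j. i < j} :: ('f, 'k) mat set) \<le> CARD('k) - 1"
    by (meson card_image_le finite_code le_trans)
  have S: "S_basis = (\<lambda>(i, j). mat_unit i j :: ('f, 'k) mat) ` {(i, j). i \<noteq> j} \<union> h_mat ` {i::'k. \<exists>j. i < j}"
    by (auto simp: S_basis_def)
  have "card (S_basis :: ('f, 'k) mat set) \<le> (CARD('k)\<^sup>2 - CARD('k)) + (CARD('k) - 1)"
    unfolding S by (rule order_trans[OF card_Un_le add_mono[OF 1 2]])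
  moreover have "CARD('k) \<le> CARD('k)\<^sup>2" "0 < CARD('k)" by (simp_all add: power2_eq_square)
  ultimately show ?thesis by linarith
qed

lemma mat_unit_in_S_basis: "i \<noteq> j \<Longrightarrow> mat_unit i j \<in> S_basis"
  by (auto simp: S_basis_def)

text \<open>
  Differences of diagonal matrix units telescope into the matrices \<open>h_mat i\<close>, by induction on
  the length of the interval between the indices.
\<close>

lemma diagonal_diff_in_span_S_basis:
  fixes i j :: "'k::{finite,linorder}"
  shows "mat_unit i i - mat_unit j j \<in> mat_vs.span (S_basis :: ('f::field, 'k) mat set)"
proof -
  have less: "mat_unit i i - mat_unit j j \<in> mat_vs.span (S_basis :: ('f, 'k) mat set)"
    if "i < j" for i j :: 'k
    using that
  proof (induction "card {i..j}" arbitrary: i rule: less_induct)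
    case less
    let ?m = "next_index i"
    have m: "i < ?m" "?m \<le> j" using next_index_greater[OF less.prems] by auto
    have h: "mat_unit i i - mat_unit ?m ?m \<in> mat_vs.span (S_basis :: ('f, 'k) mat set)"
      using less.prems by (intro mat_vs.span_base) (auto simp: S_basis_def h_mat_def)
    show ?case
    proof (cases "?m = j")
      case False
      have "{?m..j} \<subset> {i..j}" using m less.prems by auto
      then have "card {?m..j} < card {i..j}" by (intro psubset_card_mono) simp_all
      then have "mat_unit ?m ?m - mat_unit j j \<in> mat_vs.span (S_basis :: ('f, 'k) mat set)"
        using less.hyps m False by simp
      from mat_vs.span_add[OF h this] show ?thesis by simp
    qed (use h in simp)
  qed
  consider "i < j" | "i = j" | "j < i" by fastforce
  then show ?thesis
  proof cases
    case 3
    from mat_vs.span_neg[OF less[OF this]] show ?thesis by simp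
  qed (use less mat_vs.span_zero in auto)
qed

text \<open>
  In \<open>k e\<^sub>i\<^sub>i = g + (\<Sum>j. e\<^sub>i\<^sub>i - e\<^sub>j\<^sub>j)\<close> the right-hand side lies in the span, and \<open>k\<close> is
  invertible in characteristic zero.
\<close>

lemma span_M_basis: "mat_vs.span (M_basis :: ('f::field_char_0, 'k::{finite,linorder}) mat set) = UNIV"
proof -
  let ?sp = "mat_vs.span (M_basis :: ('f, 'k) mat set)"
  have S: "mat_vs.span S_basis \<subseteq> ?sp"
    by (rule mat_vs.span_mono) (auto simp: M_basis_def)
  have g: "g_mat \<in> ?sp" by (intro mat_vs.span_base) (simp add: M_basis_def)
  have diag: "mat_unit i i \<in> ?sp" for i
  proof -
    have "(g_mat + (\<Sum>j\<in>UNIV. mat_unit i i - mat_unit j j) :: ('f, 'k) mat) $ r $ s =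
        mscale (of_nat CARD('k)) (mat_unit i i) $ r $ s" for r s
    proof -
      have g: "(\<Sum>j\<in>UNIV. mat_unit j j $ r $ s) = (g_mat $ r $ s :: 'f)"
        by (cases "r = s") (auto simp: g_mat_def mat_def mat_unit_nth intro!: sum.neutral)
      show ?thesis
        unfolding vector_add_component sum_component vector_minus_component mscale_nth
        by (simp add: sum_subtractf g)
    qed
    then have "g_mat + (\<Sum>j\<in>UNIV. mat_unit i i - mat_unit j j) =
        (mscale (of_nat CARD('k)) (mat_unit i i) :: ('f, 'k) mat)"
      by (simp only: vec_eq_iff simp_thms)
    moreover have "g_mat + (\<Sum>j\<in>UNIV. mat_unit i i - mat_unit j j) \<in> ?sp"
      using S diagonal_diff_in_span_S_basis by (intro mat_vs.span_add g mat_vs.span_sum) blast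
    ultimately have "mscale (of_nat CARD('k)) (mat_unit i i) \<in> ?sp" by metis
    from mat_vs.span_scale[OF this, of "inverse (of_nat CARD('k))"] show ?thesis by simp
  qed
  have "mat_unit i j \<in> ?sp" for i j
    using diag mat_vs.span_base[of "mat_unit i j" M_basis] mat_unit_in_S_basis[of i j]
    unfolding M_basis_def by (cases "i = j") auto
  then have "A \<in> ?sp" for A
    by (subst sum_mat_units) (auto intro!: mat_vs.span_sum mat_vs.span_scale)
  then show ?thesis by blast
qed

lemma finite_M_basis: "finite (M_basis :: ('f::field, 'k::{finite,linorder}) mat set)"
  by (simp add: M_basis_def finite_S_basis)

text \<open>
  A spanning set with at most as many elements as the dimension is a basis, and then nothing was
  lost in counting: the index families are injective and \<open>g_mat\<close> is a new element.
\<close>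

lemma M_basis_facts:
  shows independent_M_basis: "mat_vs.independent (M_basis :: ('f::field_char_0, 'k::{finite,linorder}) mat set)"
    and card_S_basis: "card (S_basis :: ('f, 'k) mat set) = CARD('k)\<^sup>2 - 1"
    and g_mat_notin_S_basis: "(g_mat :: ('f, 'k) mat) \<notin> S_basis"
proof -
  let ?M = "M_basis :: ('f, 'k) mat set" and ?S = "S_basis :: ('f, 'k) mat set"
  have finM: "finite ?M" by (rule finite_M_basis)
  have le: "card ?M \<le> Suc (card ?S)"
    unfolding M_basis_def by (rule card_insert_le_m1) simp_all
  have dim: "mat_vs.dim (UNIV :: ('f, 'k) mat set) = CARD('k)\<^sup>2" by (rule dim_matrices)
  have "card ?M \<ge> CARD('k)\<^sup>2"
    using mat_vs.span_card_ge_dim[of ?M UNIV] finM span_M_basis dim by fastforce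
  then have eq: "card ?M = Suc (card ?S)" "card ?M = CARD('k)\<^sup>2"
    using le card_S_basis_le[where 'f='f and 'k='k] by linarith+
  show "mat_vs.independent ?M"
    using finM by (intro mat_vs.card_le_dim_spanning[of ?M UNIV])
      (simp_all only: span_M_basis dim eq(2) subset_UNIV order_refl)
  show "card ?S = CARD('k)\<^sup>2 - 1" using eq by simp
  show "(g_mat :: ('f, 'k) mat) \<notin> ?S"
    using eq(1) finite_S_basis by (auto simp: M_basis_def insert_absorb)
qed

definition coord :: "('f::field_char_0, 'k::{finite,linorder}) mat \<Rightarrow> ('f, 'k) mat \<Rightarrow> 'f" where
  "coord a x = mat_vs.representation M_basis x a"

lemma coord_linear [simp]:
  "coord a (x + y) = coord a x + coord a y" "coord a (mscale c x) = c * coord a x" "coord a 0 = 0"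
  by (simp_all add: coord_def mat_vs.representation_add mat_vs.representation_scale
      independent_M_basis span_M_basis mat_vs.representation_zero)

lemma coord_sum: "coord a (sum f A) = (\<Sum>x\<in>A. coord a (f x))"
  by (induction A rule: infinite_finite_induct) auto

lemma coord_basis: "b \<in> M_basis \<Longrightarrow> coord a b = (if a = b then 1 else 0)"
  by (simp add: coord_def mat_vs.representation_basis independent_M_basis)

lemma sum_coord: "(\<Sum>a\<in>M_basis. mscale (coord a x) a) = x" for x :: "('f::field_char_0, 'k::{finite,linorder}) mat"
  unfolding coord_def
  by (rule mat_vs.sum_representation_eq)
    (simp_all add: independent_M_basis span_M_basis finite_M_basis)

text \<open>
  This is the form in which the maps are used below; it also discharges the existence and
  uniqueness that the definite description in \<open>elem_map\<close> presupposes.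
\<close>

lemma elem_map_eq:
  assumes "a \<in> M_basis"
  shows "elem_map a b = (\<lambda>x. mscale (coord a x) b)"
  unfolding elem_map_def
proof (rule the_equality)
  let ?f = "\<lambda>x. mscale (coord a x) b"
  have lin: "Vector_Spaces.linear mscale mscale ?f"
    by (simp add: Vector_Spaces.linear_iff vector_space_mscale mat_vs.scale_left_distrib)
  show P: "Vector_Spaces.linear mscale mscale ?f \<and> ?f a = b \<and> (\<forall>c\<in>M_basis - {a}. ?f c = 0)"
    using lin assms by (auto simp: coord_basis)
  fix f :: "('a, 'b) mat \<Rightarrow> ('a, 'b) mat"
  assume f: "Vector_Spaces.linear mscale mscale f \<and> f a = b \<and> (\<forall>c\<in>M_basis - {a}. f c = 0)"
  interpret vector_space_pair "mscale :: _ \<Rightarrow> ('a, 'b) mat \<Rightarrow> _" "mscale :: _ \<Rightarrow> ('a, 'b) mat \<Rightarrow> _"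
    by unfold_locales
  show "f = ?f"
  proof
    fix x
    show "f x = ?f x"
    proof (rule linear_eq_on[OF conjunct1[OF f] lin])
      show "x \<in> mat_vs.span M_basis" by (simp add: span_M_basis)
      show "f c = ?f c" if "c \<in> M_basis" for c
        using f P that by (cases "c = a") auto
    qed
  qed
qed

text \<open>The relations of matrix units, for matrices indexed by the basis.\<close>

lemma elem_map_comp:
  fixes a b c d :: "('f::field_char_0, 'k::{finite,linorder}) mat"
  assumes "a \<in> M_basis" "b \<in> M_basis" "c \<in> M_basis"
  shows "elem_map b d \<circ> elem_map a c = (if b = c then elem_map a d else (\<lambda>_. 0))"
  using assms by (auto simp: elem_map_eq fun_eq_iff coord_basis)

section \<open>Elementary maps as operators in \<open>U\<close>\<close>

lemma U_alg_eq: "U_alg = free_lift mscale (\<lambda>D. D) ` free_alg matrix_der"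
  unfolding U_alg_def U_der_def uea_def quotient_def
  by (auto simp: phi_class image_iff)

lemma matrix_der_linear:
  "D \<in> matrix_der \<Longrightarrow> Vector_Spaces.linear mscale mscale D"
  by (simp add: matrix_der_def derivations_def)

lemmas matrix_der_free_lift =
  free_lift_add[OF vector_space_mscale matrix_der_linear, where \<delta> = "\<lambda>D. D"]
  free_lift_fscale[OF vector_space_mscale matrix_der_linear, where \<delta> = "\<lambda>D. D"]
  free_lift_mult[OF vector_space_mscale matrix_der_linear, where \<delta> = "\<lambda>D. D"]
  free_lift_monom[OF vector_space_mscale matrix_der_linear, where \<delta> = "\<lambda>D. D"]

lemma U_alg_add: "u \<in> U_alg \<Longrightarrow> v \<in> U_alg \<Longrightarrow> u + v \<in> U_alg"
  unfolding U_alg_eq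
  by (auto simp flip: matrix_der_free_lift(1) intro!: imageI add_free_alg)

lemma U_alg_scale: "u \<in> U_alg \<Longrightarrow> opscale mscale c u \<in> U_alg"
  unfolding U_alg_eq
  by (auto simp flip: matrix_der_free_lift(2) intro!: imageI fscale_free_alg)

lemma U_alg_comp: "u \<in> U_alg \<Longrightarrow> v \<in> U_alg \<Longrightarrow> u \<circ> v \<in> U_alg"
  unfolding U_alg_eq
  by (auto simp flip: matrix_der_free_lift(3) intro!: imageI mult_free_alg)

lemma id_in_U_alg: "id \<in> U_alg"
proof -
  have "free_lift mscale (\<lambda>D. D) (monom []) = id" by (simp add: matrix_der_free_lift id_def)
  then show ?thesis unfolding U_alg_eq by (metis image_eqI monom_free_alg empty_set empty_subsetI)
qed

lemma matrix_der_subset_U_alg: "D \<in> matrix_der \<Longrightarrow> D \<in> U_alg"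
proof -
  assume "D \<in> matrix_der"
  moreover have "free_lift mscale (\<lambda>D. D) (monom [D]) = D" by (simp add: matrix_der_free_lift)
  ultimately show ?thesis
    unfolding U_alg_eq by (intro image_eqI[of _ _ "monom [D]"] monom_free_alg) auto
qed

lemma U_alg_zero: "(\<lambda>_. 0) \<in> U_alg"
  using U_alg_scale[OF id_in_U_alg, of 0] by (simp add: opscale_def)

lemma U_alg_sum: "(\<And>i. i \<in> X \<Longrightarrow> u i \<in> U_alg) \<Longrightarrow> (\<lambda>x. \<Sum>i\<in>X. u i x) \<in> U_alg"
proof (induction X rule: infinite_finite_induct)
  case (insert i X)
  then have "u i + (\<lambda>x. \<Sum>i\<in>X. u i x) \<in> U_alg" by (intro U_alg_add) auto
  with insert.hyps show ?case by (simp add: plus_fun_def)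
qed (simp_all add: U_alg_zero)

definition ad :: "('f::field, 'k::finite) mat \<Rightarrow> ('f, 'k) mat \<Rightarrow> ('f, 'k) mat" where
  "ad c x = c ** x - x ** c"

lemma mat_mult_mscale:
  "mscale c A ** B = mscale c (A ** B)" "A ** mscale c B = mscale c (A ** B)"
  for A B :: "('f::field, 'k::finite) mat"
  by (simp_all add: mscale_def matrix_matrix_mult_def vec_eq_iff sum_distrib_left mult_ac)

lemma mat_mult_distrib:
  "(A + B) ** C = A ** C + B ** C" "A ** (B + C) = A ** B + A ** C"
  "(A - B) ** C = A ** C - B ** C" "A ** (B - C) = A ** B - A ** C"
  for A B C :: "('f::field, 'k::finite) mat"
  by (simp_all add: matrix_matrix_mult_def vec_eq_iff sum.distrib sum_subtractf algebra_simps)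

lemma ad_in_U_alg: "ad c \<in> U_alg"
proof (rule matrix_der_subset_U_alg)
  show "ad c \<in> matrix_der"
    by (simp add: matrix_der_def derivations_def Vector_Spaces.linear_iff vector_space_mscale
        ad_def mat_mult_mscale mat_mult_distrib matrix_mul_assoc mat_vs.scale_right_diff_distrib)
qed

lemma ad_mat_unit_nth:
  "ad (mat_unit i j) x $ r $ s = (if r = i then x $ j $ s else 0) - (if s = j then x $ r $ i else 0)"
  by (simp add: ad_def mat_unit_mult_nth)

text \<open>
  Since \<open>e = mat_unit i j\<close> squares to zero, the square of \<open>ad e\<close> is \<open>x \<mapsto> - 2 e x e\<close>, which has
  rank one. All further operators are obtained from this one.
\<close>

lemma rank_one_in_U_alg:
  fixes i j :: "'k::finite"
  assumes "i \<noteq> j"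
  shows "(\<lambda>x :: ('f::field_char_0, 'k) mat. mscale (x $ j $ i) (mat_unit i j)) \<in> U_alg"
proof -
  have "(\<lambda>x :: ('f, 'k) mat. mscale (x $ j $ i) (mat_unit i j)) =
      opscale mscale (- 1 / 2) (ad (mat_unit i j) \<circ> ad (mat_unit i j))"
    using assms by (auto simp: fun_eq_iff vec_eq_iff opscale_def ad_mat_unit_nth mat_unit_nth)
  then show ?thesis by (simp only:) (intro U_alg_scale U_alg_comp ad_in_U_alg)
qed

text \<open>
  Simplicity of \<open>sl\<^sub>k\<close>: the submodule of the adjoint representation generated by one
  off-diagonal matrix unit contains all of the traceless basis.
\<close>

lemma S_basis_subset_ad_submodule:
  fixes V :: "('f::field_char_0, 'k::{finite,linorder}) mat set"
  assumes scale: "\<And>c x. x \<in> V \<Longrightarrow> mscale c x \<in> V"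
    and ad: "\<And>c x. x \<in> V \<Longrightarrow> ad c x \<in> V"
    and start: "mat_unit i j \<in> V" "i \<noteq> j"
  shows "S_basis \<subseteq> V"
proof -
  have row: "mat_unit p q \<in> V" if "mat_unit r q \<in> V" "r \<noteq> q" "p \<noteq> q" for p q r
  proof (cases "p = r")
    case False
    have "ad (mat_unit p r) (mat_unit r q) = (mat_unit p q :: ('f, 'k) mat)"
      using that False by (auto simp: vec_eq_iff ad_mat_unit_nth mat_unit_nth)
    then show ?thesis using ad[OF that(1), of "mat_unit p r"] by simp
  qed (use that in simp)
  have col: "mat_unit p q \<in> V" if "mat_unit p r \<in> V" "p \<noteq> r" "p \<noteq> q" for p q r
  proof (cases "q = r")
    case False
    have "mscale (- 1) (ad (mat_unit r q) (mat_unit p r)) = (mat_unit p q :: ('f, 'k) mat)"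
      using that False by (auto simp: vec_eq_iff ad_mat_unit_nth mat_unit_nth)
    then show ?thesis using scale[OF ad[OF that(1), of "mat_unit r q"], of "- 1"] by simp
  qed (use that in simp)
  have flip: "mat_unit q p \<in> V" if "mat_unit p q \<in> V" "p \<noteq> q" for p q
  proof -
    have "mscale (- 1 / 2) (ad (mat_unit q p) (ad (mat_unit q p) (mat_unit p q))) =
        (mat_unit q p :: ('f, 'k) mat)"
      using that by (auto simp: vec_eq_iff ad_mat_unit_nth mat_unit_nth)
    then show ?thesis
      using scale[OF ad[OF ad[OF that(1)]], of "- 1 / 2" "mat_unit q p" "mat_unit q p"] by simp
  qed
  have off: "mat_unit p q \<in> V" if "p \<noteq> q" for p q
  proof (cases "q = i")
    case False
    then show ?thesis using row[OF col[OF start(1,2)]] that by metis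
  next
    case q: True
    show ?thesis
    proof (cases "p = j")
      case True
      then show ?thesis using flip[OF start] q by simp
    next
      case False
      then show ?thesis using col[OF row[OF start]] that q by metis
    qed
  qed
  have "mat_unit p p - mat_unit q q \<in> V" if "p \<noteq> q" for p q
  proof -
    have "ad (mat_unit p q) (mat_unit q p) = (mat_unit p p - mat_unit q q :: ('f, 'k) mat)"
      using that by (auto simp: vec_eq_iff ad_mat_unit_nth mat_unit_nth)
    then show ?thesis using ad[OF off, of q p "mat_unit p q"] that by simp
  qed
  then have "h_mat p \<in> V" if "p < q" for p q :: 'k
    using next_index_greater(1)[OF that] unfolding h_mat_def by (metis order_less_irrefl)
  then show ?thesis using off by (auto simp: S_basis_def)
qed

text \<open>
  Composing with \<open>ad c\<close> on the left moves the vector \<open>v\<close> in an operator \<open>x \<mapsto> f(x) v\<close>. So the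
  vectors that a fixed off-diagonal entry \<open>f\<close> admits form a submodule, and simplicity applies.
\<close>

lemma entry_functional_in_U_alg:
  fixes b :: "('f::field_char_0, 'k::{finite,linorder}) mat"
  assumes "b \<in> S_basis" "i \<noteq> j"
  shows "(\<lambda>x. mscale (x $ i $ j) b) \<in> U_alg"
proof -
  let ?V = "{v :: ('f, 'k) mat. (\<lambda>x :: ('f, 'k) mat. mscale (x $ i $ j) v) \<in> U_alg}"
  have "S_basis \<subseteq> ?V"
  proof (rule S_basis_subset_ad_submodule)
    show "mat_unit j i \<in> ?V" using assms(2) by (simp add: rank_one_in_U_alg)
    show "mscale c x \<in> ?V" if "x \<in> ?V" for c x
      using U_alg_scale[of "\<lambda>y. mscale (y $ i $ j) x" c] that
      by (simp add: opscale_def mult.commute)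
    show "ad c x \<in> ?V" if "x \<in> ?V" for c x
      using U_alg_comp[OF ad_in_U_alg, of "\<lambda>y. mscale (y $ i $ j) x" c] that
      by (simp add: comp_def ad_def mat_mult_mscale mat_vs.scale_right_diff_distrib)
  qed (use assms(2) in auto)
  with assms(1) show ?thesis by blast
qed

text \<open>
  Composing with \<open>ad c\<close> on the right moves the functional instead: the \<open>(j, i)\<close> entry of
  \<open>[e\<^sub>j\<^sub>i, x]\<close> is \<open>x\<^sub>i\<^sub>i - x\<^sub>j\<^sub>j\<close>.
\<close>

lemma diagonal_functional_in_U_alg:
  fixes b :: "('f::field_char_0, 'k::{finite,linorder}) mat"
  assumes "b \<in> S_basis"
  shows "(\<lambda>x. mscale (x $ i $ i - x $ j $ j) b) \<in> U_alg"
proof (cases "i = j")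
  case False
  then have "(\<lambda>x. mscale (x $ j $ i) b) \<circ> ad (mat_unit j i) \<in> U_alg"
    using assms by (intro U_alg_comp entry_functional_in_U_alg ad_in_U_alg) auto
  then show ?thesis by (simp add: comp_def ad_mat_unit_nth)
qed (simp add: U_alg_zero)

text \<open>
  The coordinate functionals other than that of \<open>g_mat\<close> kill \<open>g_mat\<close>. Hence they are
  combinations of off-diagonal entries and differences of diagonal entries.
\<close>

lemma elem_map_S_in_U_alg:
  fixes a b :: "('f::field_char_0, 'k::{finite,linorder}) mat"
  assumes a: "a \<in> S_basis" and b: "b \<in> S_basis"
  shows "elem_map a b \<in> U_alg"
proof -
  \<comment> \<open>an arbitrary index, against which the diagonal entries are compared\<close>
  obtain m :: 'k where True by blast
  let ?c = "\<lambda>i j. coord a (mat_unit i j)"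
  have "g_mat = (\<Sum>i\<in>UNIV. mat_unit i i :: ('f, 'k) mat)"
  proof -
    have "(\<Sum>i\<in>UNIV. mat_unit i i $ r $ s) = (g_mat $ r $ s :: 'f)" for r s :: 'k
      by (cases "r = s") (auto simp: g_mat_def mat_def mat_unit_nth intro!: sum.neutral)
    then show ?thesis by (simp add: vec_eq_iff)
  qed
  moreover have "coord a g_mat = 0"
    using a g_mat_notin_S_basis by (subst coord_basis) (auto simp: M_basis_def)
  ultimately have tr: "(\<Sum>i\<in>UNIV. ?c i i) = 0" by (simp flip: coord_sum)
  have sum: "coord a x = (\<Sum>(i, j)\<in>UNIV. ?c i j * (if i = j then x $ i $ i - x $ m $ m else x $ i $ j))" for x
  proof -
    have diag: "(\<Sum>p\<in>UNIV. case p of (i, j) \<Rightarrow> if i = j then ?c i i * x $ m $ m else 0) =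
        (\<Sum>i\<in>UNIV. ?c i i * x $ m $ m)"
      unfolding UNIV_Times_UNIV[symmetric] sum.cartesian_product[symmetric] by simp
    have "coord a x = (\<Sum>(i, j)\<in>UNIV. ?c i j * x $ i $ j)"
      by (subst sum_mat_units) (simp add: coord_sum case_prod_unfold mult.commute)
    also have "\<dots> = (\<Sum>(i, j)\<in>UNIV. ?c i j * (if i = j then x $ i $ i - x $ m $ m else x $ i $ j)) +
        (\<Sum>(i, j)\<in>UNIV. if i = j then ?c i i * x $ m $ m else 0)"
      unfolding sum.distrib[symmetric] by (intro sum.cong) (auto simp: algebra_simps)
    finally show ?thesis unfolding diag by (simp add: tr flip: sum_distrib_right)
  qed
  have eq: "elem_map a b = (\<lambda>x. \<Sum>p\<in>UNIV. opscale mscale (?c (fst p) (snd p))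
      (\<lambda>x. mscale (if fst p = snd p then x $ fst p $ fst p - x $ m $ m else x $ fst p $ snd p) b) x)"
  proof
    fix x
    have "elem_map a b x = mscale (coord a x) b" using a by (simp add: elem_map_eq M_basis_def)
    also have "\<dots> = (\<Sum>(i, j)\<in>UNIV. mscale (?c i j)
        (mscale (if i = j then x $ i $ i - x $ m $ m else x $ i $ j) b))"
      by (subst sum) (simp add: mat_vs.scale_sum_left case_prod_unfold)
    finally show "elem_map a b x = (\<Sum>p\<in>UNIV. opscale mscale (?c (fst p) (snd p))
        (\<lambda>x. mscale (if fst p = snd p then x $ fst p $ fst p - x $ m $ m else x $ fst p $ snd p) b) x)"
      by (simp only: opscale_def case_prod_unfold)
  qed
  have "(\<lambda>x. mscale (if i = j then x $ i $ i - x $ m $ m else x $ i $ j) b) \<in> U_alg" for i j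
    using b by (cases "i = j") (simp_all add: diagonal_functional_in_U_alg entry_functional_in_U_alg)
  then show ?thesis unfolding eq by (intro U_alg_sum U_alg_scale) 
qed

text \<open>
  The elementary maps on the diagonal sum to the identity, so the last one is the identity minus
  the others.
\<close>

lemma elem_map_g_in_U_alg:
  "elem_map (g_mat :: ('f::field_char_0, 'k::{finite,linorder}) mat) g_mat \<in> U_alg"
proof -
  have "elem_map g_mat g_mat x = x + mscale (- 1) (\<Sum>a\<in>S_basis. elem_map a a x)"
    for x :: "('f, 'k) mat"
  proof -
    have "x = mscale (coord g_mat x) g_mat + (\<Sum>a\<in>S_basis. mscale (coord a x) a)"
      using sum_coord[of x] by (simp add: M_basis_def g_mat_notin_S_basis finite_S_basis)
    moreover have "(\<Sum>a\<in>S_basis. mscale (coord a x) a) = (\<Sum>a\<in>S_basis. elem_map a a x)"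
      by (intro sum.cong) (simp_all add: elem_map_eq M_basis_def)
    moreover have "elem_map g_mat g_mat x = mscale (coord g_mat x) g_mat"
      by (simp add: elem_map_eq M_basis_def)
    moreover have "mscale (- 1) y = - y" for y :: "('f, 'k) mat"
      by (simp add: vec_eq_iff)
    ultimately show ?thesis by (simp only: diff_conv_add_uminus[symmetric] add_diff_cancel_right' eq_diff_eq)
  qed
  then have eq: "elem_map (g_mat :: ('f, 'k) mat) g_mat =
      id + opscale mscale (- 1) (\<lambda>x. \<Sum>a\<in>S_basis. elem_map a a x)"
    by (simp add: fun_eq_iff opscale_def)
  show ?thesis unfolding eq
    by (intro U_alg_add U_alg_scale U_alg_sum id_in_U_alg elem_map_S_in_U_alg)
qed

lemma elem_map_in_U_alg:
  "(a, b) \<in> exponents \<Longrightarrow> elem_map a b \<in> U_alg"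
  for a b :: "('f::field_char_0, 'k::{finite,linorder}) mat"
  by (auto simp: exponents_def elem_map_S_in_U_alg elem_map_g_in_U_alg)

lemma exponents_in_M_basis: "(a, b) \<in> exponents \<Longrightarrow> a \<in> M_basis \<and> b \<in> M_basis"
  by (auto simp: exponents_def M_basis_def)

text \<open>
  The laws of the action hold for elements of \<open>U\<close>, so the membership proved above transfers the
  relations of matrix units to the algebra. Both parts of the theorem rest on this relation.
\<close>

lemma act_elem_map_comp:
  fixes act :: "(('f::field_char_0, 'k::{finite,linorder}) mat \<Rightarrow> ('f, 'k) mat) \<Rightarrow> 'a::ring \<Rightarrow> 'a"
  assumes "LU_algebra scl \<delta> act" "(a, c) \<in> exponents" "(b, d) \<in> exponents"
  shows "act (elem_map b d) (act (elem_map a c) x) = (if b = c then act (elem_map a d) x else 0)"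
proof -
  interpret LU_algebra scl \<delta> act by fact
  have "act (elem_map b d \<circ> elem_map a c) x = act (elem_map b d) (act (elem_map a c) x)"
    using assms(2,3) by (intro act_comp elem_map_in_U_alg)
  moreover have "act (\<lambda>_. 0) x = 0"
    using act_scale[OF id_in_U_alg, of 0 x] by (simp add: opscale_def)
  ultimately show ?thesis
    using elem_map_comp[of a b c d] exponents_in_M_basis[OF assms(2)] exponents_in_M_basis[OF assms(3)]
    by (simp split: if_splits)
qed

section \<open>Linear maps and coordinate subspaces of the free algebra\<close>

text \<open>
  Evaluation, renaming of letters and projection to a set of words are all linear extensions of
  maps on words, so that linearity and composition are treated once for the three of them.
\<close>

definition lin_ext ::
  "('f::field \<Rightarrow> 'b \<Rightarrow> 'b) \<Rightarrow> ('m \<Rightarrow> 'b) \<Rightarrow> ('m \<Rightarrow>\<^sub>0 'f) \<Rightarrow> 'b::ab_group_add" where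
  "lin_ext scl h p = (\<Sum>w\<in>Poly_Mapping.keys p. scl (Poly_Mapping.lookup p w) (h w))"

lemma lin_ext_cong:
  "(\<And>w. w \<in> Poly_Mapping.keys p \<Longrightarrow> h w = h' w) \<Longrightarrow> lin_ext scl h p = lin_ext scl h' p"
  by (simp add: lin_ext_def)

context vector_space
begin

lemma lin_ext_superset:
  assumes "finite T" "Poly_Mapping.keys p \<subseteq> T"
  shows "lin_ext scale h p = (\<Sum>w\<in>T. Poly_Mapping.lookup p w *s h w)"
  unfolding lin_ext_def using assms
  by (intro sum.mono_neutral_left) (auto simp: in_keys_iff)

lemma lin_ext_add: "lin_ext scale h (p + q) = lin_ext scale h p + lin_ext scale h q"
proof -
  let ?T = "Poly_Mapping.keys p \<union> Poly_Mapping.keys q"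
  show ?thesis
    using Poly_Mapping.keys_add[of p q]
    by (simp add: lin_ext_superset[of ?T] lookup_add scale_left_distrib sum.distrib)
qed

lemma lin_ext_fscale: "lin_ext scale h (fscale c p) = c *s lin_ext scale h p"
proof -
  have "Poly_Mapping.keys (fscale c p) \<subseteq> Poly_Mapping.keys p" by (auto simp: in_keys_iff)
  then show ?thesis
    by (simp add: lin_ext_superset[of "Poly_Mapping.keys p"] scale_sum_right)
qed

lemma linear_lin_ext: "Vector_Spaces.linear fscale scale (lin_ext scale h)"
  by (simp add: Vector_Spaces.linear_iff lin_ext_add lin_ext_fscale vector_space_axioms
      free_vs.vector_space_axioms)

lemma lin_ext_single: "lin_ext scale h (Poly_Mapping.single w 1) = h w"
  by (simp add: lin_ext_superset[of "{w}"] lookup_single)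

lemma lin_ext_lin_ext:
  "lin_ext scale h (lin_ext fscale r p) = lin_ext scale (\<lambda>w. lin_ext scale h (r w)) p"
proof -
  have "lin_ext scale h (sum f X) = (\<Sum>w\<in>X. lin_ext scale h (f w))" for f X
    by (induction X rule: infinite_finite_induct) (simp_all add: lin_ext_add, simp_all add: lin_ext_def)
  then have "lin_ext scale h (lin_ext fscale r p) =
      (\<Sum>w\<in>Poly_Mapping.keys p. lin_ext scale h (fscale (Poly_Mapping.lookup p w) (r w)))"
    by (subst lin_ext_def[of fscale])
  then show ?thesis by (simp only: lin_ext_fscale lin_ext_def[of scale _ p])
qed

end

lemma lin_ext_id: "lin_ext fscale (\<lambda>w. Poly_Mapping.single w 1) p = p"
proof -
  have "fscale c (Poly_Mapping.single w 1) = Poly_Mapping.single w c" for c :: "'b::field" and w :: 'a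
    by (intro poly_mapping_eqI) (simp add: lookup_single when_def)
  then show ?thesis
    unfolding lin_ext_def by (simp flip: poly_mapping_sum_singles)
qed

definition coord_space :: "'m set \<Rightarrow> ('m \<Rightarrow>\<^sub>0 'f::field) set" where
  "coord_space K = {p. Poly_Mapping.keys p \<subseteq> K}"

lemma subspace_coord_space: "free_vs.subspace (coord_space K :: ('m \<Rightarrow>\<^sub>0 'f::field) set)"
proof -
  have "p \<in> coord_space K \<longleftrightarrow> (\<forall>w. w \<notin> K \<longrightarrow> Poly_Mapping.lookup p w = 0)" for p :: "'m \<Rightarrow>\<^sub>0 'f"
    unfolding coord_space_def by (auto simp: in_keys_iff)
  then show ?thesis by (simp add: free_vs.subspace_def lookup_add)
qed

lemma span_singles: "free_vs.span ((\<lambda>w. Poly_Mapping.single w (1::'f::field)) ` K) = coord_space K"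
proof
  show "free_vs.span ((\<lambda>w. Poly_Mapping.single w (1::'f)) ` K) \<subseteq> coord_space K"
    by (rule free_vs.span_minimal[OF _ subspace_coord_space]) (auto simp: coord_space_def)
  show "coord_space K \<subseteq> free_vs.span ((\<lambda>w. Poly_Mapping.single w (1::'f)) ` K)"
  proof
    fix p :: "'a \<Rightarrow>\<^sub>0 'f"
    assume "p \<in> coord_space K"
    then have "lin_ext fscale (\<lambda>w. Poly_Mapping.single w 1) p \<in>
        free_vs.span ((\<lambda>w. Poly_Mapping.single w (1::'f)) ` K)"
      unfolding lin_ext_def coord_space_def
      by (intro free_vs.span_sum free_vs.span_scale free_vs.span_base) auto
    then show "p \<in> free_vs.span ((\<lambda>w. Poly_Mapping.single w (1::'f)) ` K)"
      by (simp add: lin_ext_id)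
  qed
qed

definition coord_proj :: "'m set \<Rightarrow> ('m \<Rightarrow>\<^sub>0 'f::field) \<Rightarrow> ('m \<Rightarrow>\<^sub>0 'f)" where
  "coord_proj K = lin_ext fscale (\<lambda>w. if w \<in> K then Poly_Mapping.single w 1 else 0)"

lemma lookup_coord_proj:
  "Poly_Mapping.lookup (coord_proj K p) w = (if w \<in> K then Poly_Mapping.lookup p w else 0)"
proof -
  have "Poly_Mapping.lookup (coord_proj K p) w =
      (\<Sum>v\<in>Poly_Mapping.keys p. if v = w then (if w \<in> K then Poly_Mapping.lookup p w else 0) else 0)"
    unfolding coord_proj_def lin_ext_def lookup_sum
    by (intro sum.cong) (auto simp: lookup_single when_def)
  also have "\<dots> = (if w \<in> K then Poly_Mapping.lookup p w else 0)"
    by (auto simp: in_keys_iff)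
  finally show ?thesis .
qed

lemma coord_proj_in_coord_space: "coord_proj K p \<in> coord_space K"
  by (auto simp: coord_space_def in_keys_iff lookup_coord_proj split: if_splits)

lemma coord_proj_id: "p \<in> coord_space K \<Longrightarrow> coord_proj K p = p"
  by (intro poly_mapping_eqI) (auto simp: coord_space_def in_keys_iff lookup_coord_proj)

lemma coord_proj_disjoint: "p \<in> coord_space K' \<Longrightarrow> K \<inter> K' = {} \<Longrightarrow> coord_proj K p = 0"
  by (intro poly_mapping_eqI) (auto simp: coord_space_def in_keys_iff lookup_coord_proj)

lemma linear_coord_proj: "Vector_Spaces.linear fscale fscale (coord_proj K)"
  unfolding coord_proj_def by (rule free_vs.linear_lin_ext)

lemma sum_coord_proj:
  assumes "finite T" "disjoint_family_on K T" "p \<in> coord_space (\<Union>t\<in>T. K t)"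
  shows "(\<Sum>t\<in>T. coord_proj (K t) p) = p"
proof (rule poly_mapping_eqI)
  fix w
  have *: "Poly_Mapping.lookup (\<Sum>t\<in>T. coord_proj (K t) p) w =
      (\<Sum>t\<in>T. if w \<in> K t then Poly_Mapping.lookup p w else 0)"
    by (simp add: lookup_sum lookup_coord_proj)
  show "Poly_Mapping.lookup (\<Sum>t\<in>T. coord_proj (K t) p) w = Poly_Mapping.lookup p w"
  proof (cases "\<exists>t\<in>T. w \<in> K t")
    case True
    then obtain t where t: "t \<in> T" "w \<in> K t" by blast
    have "w \<in> K s \<longleftrightarrow> s = t" if "s \<in> T" for s
      using assms(2) t that by (auto simp: disjoint_family_on_def)
    then have "(\<Sum>s\<in>T. if w \<in> K s then Poly_Mapping.lookup p w else 0) =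
        (\<Sum>s\<in>T. if s = t then Poly_Mapping.lookup p w else 0)"
      by (intro sum.cong) auto
    with * t assms(1) show ?thesis by simp
  next
    case False
    then have "Poly_Mapping.lookup p w = 0"
      using assms(3) by (auto simp: coord_space_def in_keys_iff)
    then show ?thesis unfolding * by (simp cong: if_cong)
  qed
qed

text \<open>
  A subspace that is stable under the coordinate projections is the direct sum of its
  intersections with the coordinate subspaces: \<open>p\<close> is the sum of its projections, and bases of
  the intersections combine to a basis because applying a projection to a linear relation
  isolates the part of the relation in one summand.
\<close>

lemma dim_eq_sum_dims:
  fixes K :: "'t \<Rightarrow> 'm set" and W :: "('m \<Rightarrow>\<^sub>0 'f::field) set"
  assumes T: "finite T" "disjoint_family_on K T" and fin: "\<And>t. t \<in> T \<Longrightarrow> finite (K t)"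
    and W: "free_vs.subspace W" "W \<subseteq> coord_space (\<Union>t\<in>T. K t)"
    and proj: "\<And>p t. p \<in> W \<Longrightarrow> t \<in> T \<Longrightarrow> coord_proj (K t) p \<in> W"
  shows "free_vs.dim W = (\<Sum>t\<in>T. free_vs.dim (coord_space (K t) \<inter> W))"
proof -
  define is_basis where "is_basis t B \<longleftrightarrow> B \<subseteq> coord_space (K t) \<inter> W \<and> free_vs.independent B \<and>
      coord_space (K t) \<inter> W \<subseteq> free_vs.span B \<and> card B = free_vs.dim (coord_space (K t) \<inter> W)" for t B
  have "\<exists>B. is_basis t B" for t
    unfolding is_basis_def
    by (rule free_vs.basis_exists[of "coord_space (K t) \<inter> W"]) (intro exI conjI)
  then obtain B where "is_basis t (B t)" for t by metis
  then have B: "B t \<subseteq> coord_space (K t)" "B t \<subseteq> W" "free_vs.independent (B t)"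
      "coord_space (K t) \<inter> W \<subseteq> free_vs.span (B t)" "card (B t) = free_vs.dim (coord_space (K t) \<inter> W)" for t
    by (simp_all add: is_basis_def)
  have projB: "coord_proj (K t) v = (if v \<in> B t then v else 0)"
    if "t \<in> T" "s \<in> T" "v \<in> B s" for s t v
  proof (cases "s = t")
    case True
    then show ?thesis using that B(1)[of t] by (auto simp: coord_proj_id)
  next
    case False
    then have "K t \<inter> K s = {}" using T(2) that by (auto simp: disjoint_family_on_def)
    then have "coord_proj (K t) v = 0" using B(1)[of s] that(3) by (auto intro: coord_proj_disjoint)
    moreover have "coord_proj (K t) v = v" if "v \<in> B t"
      using that B(1)[of t] by (auto simp: coord_proj_id)
    ultimately show ?thesis by auto
  qed
  have disj: "B s \<inter> B t = {}" if "s \<in> T" "t \<in> T" "s \<noteq> t" for s t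
  proof (rule ccontr)
    assume "B s \<inter> B t \<noteq> {}"
    then obtain v where v: "v \<in> B s" "v \<in> B t" by blast
    have "K t \<inter> K s = {}" using T(2) that by (auto simp: disjoint_family_on_def)
    then have "v = 0"
      using coord_proj_disjoint[of v "K s" "K t"] coord_proj_id[of v "K t"]
        subsetD[OF B(1) v(1)] subsetD[OF B(1) v(2)] by simp
    then show False using B(3)[of s] v(1) free_vs.dependent_zero by blast
  qed
  have finB: "finite (B t)" if "t \<in> T" for t
  proof -
    have "finite ((\<lambda>w. Poly_Mapping.single w (1::'f)) ` K t)" using fin[OF that] by simp
    from free_vs.independent_span_bound[OF this B(3)] B(1) show ?thesis by (simp add: span_singles)
  qed
  have "free_vs.independent (\<Union>t\<in>T. B t)"
    unfolding free_vs.independent_explicit_finite_subsets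
  proof (intro allI impI ballI)
    fix A u v
    assume A: "A \<subseteq> (\<Union>t\<in>T. B t)" "finite A" "(\<Sum>v\<in>A. fscale (u v) v) = 0" and v: "v \<in> A"
    obtain t where t: "t \<in> T" "v \<in> B t" using A(1) v by blast
    interpret P: Vector_Spaces.linear fscale fscale "coord_proj (K t)" by (rule linear_coord_proj)
    have "0 = coord_proj (K t) (\<Sum>v\<in>A. fscale (u v) v)" by (simp add: A(3) P.zero)
    also have "\<dots> = (\<Sum>v\<in>A. fscale (u v) (if v \<in> B t then v else 0))"
      unfolding P.sum P.scale
    proof (rule sum.cong[OF refl])
      fix x assume "x \<in> A"
      then obtain s where "s \<in> T" "x \<in> B s" using A(1) by blast
      then show "fscale (u x) (coord_proj (K t) x) = fscale (u x) (if x \<in> B t then x else 0)"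
        using projB[OF t(1)] by simp
    qed
    also have "\<dots> = (\<Sum>v\<in>A \<inter> B t. fscale (u v) v)"
      by (intro sum.mono_neutral_cong_right) (use A(2) in auto)
    finally have "(\<Sum>v\<in>A \<inter> B t. fscale (u v) v) = 0" by (rule sym)
    moreover have "finite (A \<inter> B t)" "A \<inter> B t \<subseteq> B t" "v \<in> A \<inter> B t" using A(2) v t(2) by auto
    ultimately show "u v = 0"
      using B(3)[of t, unfolded free_vs.independent_explicit_finite_subsets] by (elim allE impE ballE) auto
  qed
  moreover have "W \<subseteq> free_vs.span (\<Union>t\<in>T. B t)"
  proof
    fix p assume p: "p \<in> W"
    have "coord_proj (K t) p \<in> free_vs.span (\<Union>t\<in>T. B t)" if "t \<in> T" for t
    proof -
      have "coord_proj (K t) p \<in> free_vs.span (B t)"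
        using B(4)[of t] proj[OF p that] coord_proj_in_coord_space by blast
      then show ?thesis using free_vs.span_mono[of "B t" "\<Union>t\<in>T. B t"] that by blast
    qed
    then have "(\<Sum>t\<in>T. coord_proj (K t) p) \<in> free_vs.span (\<Union>t\<in>T. B t)"
      by (rule free_vs.span_sum)
    then show "p \<in> free_vs.span (\<Union>t\<in>T. B t)"
      unfolding sum_coord_proj[OF T subsetD[OF W(2) p]] .
  qed
  moreover have "(\<Union>t\<in>T. B t) \<subseteq> W" using B(2) by blast
  ultimately have "free_vs.dim W = card (\<Union>t\<in>T. B t)"
    by (intro free_vs.basis_card_eq_dim[symmetric])
  also have "\<dots> = (\<Sum>t\<in>T. card (B t))"
    using T(1) finB disj by (intro card_UN_disjoint) auto
  finally show ?thesis by (simp add: B(5))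
qed

lemma quotient_dim_coord_space:
  fixes W :: "('m \<Rightarrow>\<^sub>0 'f::field) set"
  assumes "finite K" "free_vs.subspace W" "W \<subseteq> coord_space K"
  shows "quotient_dim (coord_space K) W + free_vs.dim W = free_vs.dim (coord_space K :: ('m \<Rightarrow>\<^sub>0 'f) set)"
  using assms
  by (intro quotient_dim_eq[of _ _ "(\<lambda>w. Poly_Mapping.single w 1) ` K"])
    (simp_all add: span_singles subspace_coord_space)

text \<open>
  The quotient dimension is a difference of dimensions, both of which are additive; the ambient
  space is stable under the projections as well.
\<close>

lemma quotient_dim_eq_sum:
  fixes K :: "'t \<Rightarrow> 'm set" and W :: "('m \<Rightarrow>\<^sub>0 'f::field) set"
  assumes T: "finite T" "disjoint_family_on K T" and fin: "\<And>t. t \<in> T \<Longrightarrow> finite (K t)"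
    and W: "free_vs.subspace W" "W \<subseteq> coord_space (\<Union>t\<in>T. K t)"
    and proj: "\<And>p t. p \<in> W \<Longrightarrow> t \<in> T \<Longrightarrow> coord_proj (K t) p \<in> W"
  shows "quotient_dim (coord_space (\<Union>t\<in>T. K t)) W =
      (\<Sum>t\<in>T. quotient_dim (coord_space (K t)) (coord_space (K t) \<inter> W))"
proof -
  let ?V = "coord_space (\<Union>t\<in>T. K t) :: ('m \<Rightarrow>\<^sub>0 'f) set"
  have KV: "coord_space (K t) \<subseteq> ?V" if "t \<in> T" for t
    using that by (auto simp: coord_space_def)
  have dimV: "free_vs.dim ?V = (\<Sum>t\<in>T. free_vs.dim (coord_space (K t) :: ('m \<Rightarrow>\<^sub>0 'f) set))"
  proof -
    have "free_vs.dim ?V = (\<Sum>t\<in>T. free_vs.dim (coord_space (K t) \<inter> ?V))"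
      using T fin KV coord_proj_in_coord_space
      by (intro dim_eq_sum_dims subspace_coord_space) blast+
    also have "\<dots> = (\<Sum>t\<in>T. free_vs.dim (coord_space (K t) :: ('m \<Rightarrow>\<^sub>0 'f) set))"
      using KV by (intro sum.cong refl) (simp add: Int_absorb2)
    finally show ?thesis .
  qed
  have dimW: "free_vs.dim W = (\<Sum>t\<in>T. free_vs.dim (coord_space (K t) \<inter> W))"
    using assms by (rule dim_eq_sum_dims)
  have each: "quotient_dim (coord_space (K t)) (coord_space (K t) \<inter> W) +
      free_vs.dim (coord_space (K t) \<inter> W) = free_vs.dim (coord_space (K t) :: ('m \<Rightarrow>\<^sub>0 'f) set)" if "t \<in> T" for t
    using fin[OF that] W(1) by (intro quotient_dim_coord_space free_vs.subspace_inter subspace_coord_space) auto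
  have "quotient_dim ?V W + free_vs.dim W = free_vs.dim ?V"
    using T(1) fin W by (intro quotient_dim_coord_space) auto
  also have "\<dots> = (\<Sum>t\<in>T. quotient_dim (coord_space (K t)) (coord_space (K t) \<inter> W)) + free_vs.dim W"
    unfolding dimV dimW sum.distrib[symmetric]
    by (intro sum.cong refl) (simp add: each)
  finally show ?thesis by simp
qed

lemma dim_injective_image:
  assumes T: "Vector_Spaces.linear fscale fscale T" and V: "free_vs.subspace V" "inj_on T V"
  shows "free_vs.dim (T ` V) = free_vs.dim V"
proof -
  interpret Vector_Spaces.linear fscale fscale T by fact
  obtain B where B: "B \<subseteq> V" "free_vs.independent B" "V \<subseteq> free_vs.span B" "card B = free_vs.dim V"
    using free_vs.basis_exists by blast
  have sp: "free_vs.span B = V" using B(1,3) V(1) free_vs.span_minimal by blast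
  have "free_vs.independent (T ` B)"
    using independent_injective_image[OF B(2)] sp V(2) by simp
  moreover have "free_vs.span (T ` B) = T ` V" using span_image[of B] sp by simp
  ultimately have "free_vs.dim (T ` V) = card (T ` B)"
    using free_vs.dim_span_eq_card_independent by metis
  moreover have "card (T ` B) = card B" using B(1) V(2) by (intro card_image) (rule inj_on_subset)
  ultimately show ?thesis using B(4) by simp
qed

lemma quotient_dim_injective_image:
  assumes T: "Vector_Spaces.linear fscale fscale T" "inj_on T (coord_space K)"
    "T ` coord_space K = coord_space K'" "T ` W = W'"
    and W: "free_vs.subspace W" "W \<subseteq> coord_space K" and fin: "finite K" "finite K'"
  shows "quotient_dim (coord_space K) W = quotient_dim (coord_space K') W'"
proof -
  interpret Vector_Spaces.linear fscale fscale T by fact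
  have "free_vs.subspace W'" "W' \<subseteq> coord_space K'"
    using W T(3,4) subspace_image[OF W(1)] by auto
  moreover have "free_vs.dim W' = free_vs.dim W"
    using dim_injective_image[OF T(1) W(1)] inj_on_subset[OF T(2) W(2)] T(4) by simp
  moreover note dim_injective_image[OF T(1) subspace_coord_space T(2), unfolded T(3)]
  ultimately show ?thesis
    using quotient_dim_coord_space[OF fin(1) W] quotient_dim_coord_space[OF fin(2), of W'] by linarith
qed

section \<open>Multilinear words\<close>

text \<open>
  Instead of a permutation and a choice of exponents, a multilinear monomial is given here by the
  word itself: its letters come from \<open>A\<close> and use each of the variables \<open>1, ..., n\<close> once. The
  spaces in the theorem then differ only in the set \<open>A\<close> of letters.
\<close>

definition multilinear_words :: "nat \<Rightarrow> (nat \<times> 'e) set \<Rightarrow> (nat \<times> 'e) word set" where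
  "multilinear_words n A = Word ` {xs. set xs \<subseteq> A \<and> distinct (map fst xs) \<and> fst ` set xs = {1..n}}"

lemma finite_multilinear_words:
  assumes "finite A" shows "finite (multilinear_words n A)"
proof -
  have "length xs = n" if "distinct (map fst xs)" "fst ` set xs = {1..n}" for xs :: "(nat \<times> 'a) list"
    using distinct_card[OF that(1)] that(2) by simp
  then have "multilinear_words n A \<subseteq> Word ` {xs. set xs \<subseteq> A \<and> length xs = n}"
    by (auto simp: multilinear_words_def)
  then show ?thesis using finite_lists_length_eq[OF assms] by (auto intro: finite_subset)
qed

lemma multilinear_words_mono: "A \<subseteq> B \<Longrightarrow> multilinear_words n A \<subseteq> multilinear_words n B"
  by (auto simp: multilinear_words_def)

lemma letters_in_coord_space:
  assumes "p \<in> coord_space (multilinear_words n A)" "w \<in> Poly_Mapping.keys p" "x \<in> set (letters w)"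
  shows "x \<in> A"
proof -
  have "w \<in> multilinear_words n A" using assms(1,2) by (auto simp: coord_space_def)
  then show ?thesis using assms(3) by (auto simp: multilinear_words_def)
qed

lemma multilinear_monomials_eq:
  fixes A :: "(nat \<times> ('f::field, 'k::finite) mat \<times> ('f, 'k) mat) set"
  shows "{multilinear_monomial n \<sigma> u | \<sigma> u. \<sigma> permutes {1..n} \<and> (\<forall>m\<in>{1..n}. (\<sigma> m, u m) \<in> A)} =
    (\<lambda>w. Poly_Mapping.single w (1::'f)) ` multilinear_words n A"
  (is "?L = ?R")
proof (intro subset_antisym subsetI)
  fix p :: "(nat \<times> ('f, 'k) mat \<times> ('f, 'k) mat) word \<Rightarrow>\<^sub>0 'f"
  assume "p \<in> ?L"
  then obtain \<sigma> u where p: "p = multilinear_monomial n \<sigma> u" and \<sigma>: "\<sigma> permutes {1..n}"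
    and u: "\<And>m. m \<in> {1..n} \<Longrightarrow> (\<sigma> m, u m) \<in> A" by blast
  let ?xs = "map (\<lambda>m. (\<sigma> m, u m)) [1..<Suc n]"
  have set: "set [1..<Suc n] = {1..n}" by auto
  have "set ?xs \<subseteq> A" using u by auto
  moreover have "map fst ?xs = map \<sigma> [1..<Suc n]" by simp
  then have "distinct (map fst ?xs)"
    using permutes_inj[OF \<sigma>] by (simp only: distinct_map distinct_upt inj_on_subset[OF _ subset_UNIV] simp_thms)
  moreover have "fst ` set ?xs = {1..n}"
    using permutes_image[OF \<sigma>] by (simp only: set set_map image_image fst_conv)
  ultimately have "Word ?xs \<in> multilinear_words n A"
    unfolding multilinear_words_def by blast
  then show "p \<in> ?R" unfolding p multilinear_monomial_def monom_def by (rule imageI)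
next
  fix p :: "(nat \<times> ('f, 'k) mat \<times> ('f, 'k) mat) word \<Rightarrow>\<^sub>0 'f"
  assume "p \<in> ?R"
  then obtain xs where p: "p = monom xs" and xs: "set xs \<subseteq> A" "distinct (map fst xs)" "fst ` set xs = {1..n}"
    by (auto simp: multilinear_words_def monom_def)
  have len: "length xs = n" using distinct_card[OF xs(2)] xs(3) by simp
  define \<sigma> where "\<sigma> m = (if m \<in> {1..n} then fst (xs ! (m - 1)) else m)" for m
  define u where "u m = snd (xs ! (m - 1))" for m
  have inj: "inj_on \<sigma> {1..n}"
  proof (rule inj_onI)
    fix l m assume lm: "l \<in> {1..n}" "m \<in> {1..n}" "\<sigma> l = \<sigma> m"
    then have "map fst xs ! (l - 1) = map fst xs ! (m - 1)" by (auto simp: \<sigma>_def len)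
    then have "l - 1 = m - 1"
      using nth_eq_iff_index_eq[OF xs(2), of "l - 1" "m - 1"] lm(1,2) len by auto
    then show "l = m" using lm(1,2) by auto
  qed
  have "\<sigma> m \<in> {1..n}" if "m \<in> {1..n}" for m
    using that xs(3) len nth_mem[of "m - 1" xs] by (auto simp: \<sigma>_def)
  then have "\<sigma> ` {1..n} = {1..n}" using inj by (intro endo_inj_surj) auto
  then have "\<sigma> permutes {1..n}"
    using inj by (intro bij_imp_permutes) (auto simp: bij_betw_def \<sigma>_def)
  moreover have "(\<sigma> m, u m) = xs ! (m - 1)" if "m \<in> {1..n}" for m
    using that by (simp add: \<sigma>_def u_def)
  then have "\<forall>m\<in>{1..n}. (\<sigma> m, u m) \<in> A" using xs(1) len nth_mem by fastforce
  moreover have "xs = map (\<lambda>m. (\<sigma> m, u m)) [1..<Suc n]"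
    by (rule nth_equalityI) (auto simp: len \<sigma>_def u_def simp del: upt_Suc)
  then have "p = multilinear_monomial n \<sigma> u" by (simp only: p multilinear_monomial_def)
  ultimately show "p \<in> ?L" by blast
qed

definition split_letters ::
  "nat set \<Rightarrow> nat set \<Rightarrow> (nat \<Rightarrow> ('f::field, 'k::{finite,linorder}) mat) \<Rightarrow> ('f, 'k) symb set" where
  "split_letters I J a = I \<times> {(g_mat, g_mat)} \<union> {(j, a j, b) | j b. j \<in> J \<and> b \<in> S_basis}"

lemma P_U_eq: "P_U n = coord_space (multilinear_words n ({1..n} \<times> exponents))"
proof -
  have "(\<forall>m\<in>{1..n}. u m \<in> exponents) \<longleftrightarrow> (\<forall>m\<in>{1..n}. (\<sigma> m, u m) \<in> {1..n} \<times> exponents)"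
    if "\<sigma> permutes {1..n}" for \<sigma> :: "nat \<Rightarrow> nat" and u :: "nat \<Rightarrow> ('a, 'b) mat \<times> ('a, 'b) mat"
    using that permutes_in_image[of \<sigma>] by (auto simp del: atLeastAtMost_iff)
  then have "{multilinear_monomial n \<sigma> u | \<sigma> (u :: nat \<Rightarrow> ('a, 'b) mat \<times> ('a, 'b) mat).
        \<sigma> permutes {1..n} \<and> (\<forall>m\<in>{1..n}. u m \<in> exponents)} =
      {multilinear_monomial n \<sigma> u | \<sigma> u.
        \<sigma> permutes {1..n} \<and> (\<forall>m\<in>{1..n}. (\<sigma> m, u m) \<in> {1..n} \<times> exponents)}"
    by (intro Collect_cong ex_cong1 conj_cong refl)
  then show ?thesis unfolding P_U_def by (simp only: multilinear_monomials_eq span_singles)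
qed

lemma P_U_split_eq:
  assumes "I \<inter> J = {}" "I \<union> J = {1..n}"
  shows "P_U_split n I J a = coord_space (multilinear_words n (split_letters I J a))"
proof -
  have "(\<forall>m\<in>{1..n}. (\<sigma> m \<in> I \<longrightarrow> u m = (g_mat, g_mat)) \<and>
        (\<sigma> m \<in> J \<longrightarrow> (\<exists>b\<in>S_basis. u m = (a (\<sigma> m), b)))) \<longleftrightarrow>
      (\<forall>m\<in>{1..n}. (\<sigma> m, u m) \<in> split_letters I J a)"
    if "\<sigma> permutes {1..n}" for \<sigma> :: "nat \<Rightarrow> nat" and u :: "nat \<Rightarrow> ('a, 'b) mat \<times> ('a, 'b) mat"
  proof (intro ball_cong refl)
    fix m assume "m \<in> {1..n}"
    then have "\<sigma> m \<in> I \<union> J" unfolding assms(2) using that by (simp only: permutes_in_image)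
    then show "((\<sigma> m \<in> I \<longrightarrow> u m = (g_mat, g_mat)) \<and>
        (\<sigma> m \<in> J \<longrightarrow> (\<exists>b\<in>S_basis. u m = (a (\<sigma> m), b)))) \<longleftrightarrow> (\<sigma> m, u m) \<in> split_letters I J a"
      using assms(1) by (auto simp: split_letters_def)
  qed
  then have "{multilinear_monomial n \<sigma> u | \<sigma> (u :: nat \<Rightarrow> ('a, 'b) mat \<times> ('a, 'b) mat).
        \<sigma> permutes {1..n} \<and> (\<forall>m\<in>{1..n}. (\<sigma> m \<in> I \<longrightarrow> u m = (g_mat, g_mat)) \<and>
        (\<sigma> m \<in> J \<longrightarrow> (\<exists>b\<in>S_basis. u m = (a (\<sigma> m), b))))} =
      {multilinear_monomial n \<sigma> u | \<sigma> u.
        \<sigma> permutes {1..n} \<and> (\<forall>m\<in>{1..n}. (\<sigma> m, u m) \<in> split_letters I J a)}"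
    by (intro Collect_cong ex_cong1 conj_cong refl)
  then show ?thesis unfolding P_U_split_def by (simp only: multilinear_monomials_eq span_singles)
qed

lemma split_letters_subset:
  "(\<And>j. j \<in> J \<Longrightarrow> a j \<in> S_basis) \<Longrightarrow> split_letters I J a \<subseteq> (I \<union> J) \<times> exponents"
  by (auto simp: split_letters_def exponents_def)

lemma finite_exponents: "finite (exponents :: (('f::field, 'k::{finite,linorder}) mat \<times> ('f, 'k) mat) set)"
  by (simp add: exponents_def finite_S_basis)

section \<open>Evaluation\<close>

lemma eval_free_eq_lin_ext: "eval_free scl \<rho> = lin_ext scl (\<lambda>w. eval_word \<rho> (letters w))"
  by (simp add: fun_eq_iff eval_free_def lin_ext_def)

lemma eval_word_cong: "(\<And>x. x \<in> set xs \<Longrightarrow> \<rho> x = \<rho>' x) \<Longrightarrow> eval_word \<rho> xs = eval_word \<rho>' xs"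
  by (induction xs rule: eval_word.induct[of _ \<rho>]) auto

lemma eval_word_map: "eval_word \<rho> (map r xs) = eval_word (\<lambda>x. \<rho> (r x)) xs"
  by (induction xs rule: induct_list012) auto

lemma eval_word_zero: "x \<in> set xs \<Longrightarrow> \<rho> x = 0 \<Longrightarrow> eval_word \<rho> xs = 0"
  by (induction xs rule: induct_list012) auto

definition sub_letters :: "('x \<Rightarrow> 'y) \<Rightarrow> ('x word \<Rightarrow>\<^sub>0 'f::field) \<Rightarrow> ('y word \<Rightarrow>\<^sub>0 'f)" where
  "sub_letters r = lin_ext fscale (\<lambda>w. Poly_Mapping.single (map_word r w) 1)"

lemma letters_map_word: "letters (map_word r w) = map r (letters w)"
  by (cases w) simp

lemma eval_sub_letters:
  assumes "vector_space scl"
  shows "eval_free scl \<rho> (sub_letters r p) = eval_free scl (\<lambda>x. \<rho> (r x)) p"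
proof -
  interpret vector_space scl by fact
  show ?thesis
    by (simp add: eval_free_eq_lin_ext sub_letters_def lin_ext_lin_ext lin_ext_single letters_map_word eval_word_map)
qed

lemma sub_letters_inverse:
  assumes "\<And>w x. w \<in> Poly_Mapping.keys p \<Longrightarrow> x \<in> set (letters w) \<Longrightarrow> s (r x) = x"
  shows "sub_letters s (sub_letters r p) = p"
proof -
  have "map_word s (map_word r w) = w" if "w \<in> Poly_Mapping.keys p" for w
    using assms[OF that] by (cases w) (auto intro!: map_idI)
  then have "sub_letters s (sub_letters r p) = lin_ext fscale (\<lambda>w. Poly_Mapping.single w 1) p"
    by (simp add: sub_letters_def free_vs.lin_ext_lin_ext free_vs.lin_ext_single cong: lin_ext_cong)
  then show ?thesis by (simp only: lin_ext_id)
qed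

lemma sub_letters_coord_space:
  assumes "p \<in> coord_space (multilinear_words n A)" and "\<And>x. x \<in> A \<Longrightarrow> r x \<in> B"
    and "\<And>x. x \<in> A \<Longrightarrow> fst (r x) = \<pi> (fst x)" and "bij_betw \<pi> {1..n} {1..n}"
  shows "sub_letters r p \<in> coord_space (multilinear_words n B)"
proof -
  have "map_word r w \<in> multilinear_words n B" if mem: "w \<in> multilinear_words n A" for w
  proof -
    obtain xs where w: "w = Word xs" and xs: "set xs \<subseteq> A" "distinct (map fst xs)" "fst ` set xs = {1..n}"
      using mem by (auto simp: multilinear_words_def)
    have eq: "map fst (map r xs) = map \<pi> (map fst xs)" using assms(3) xs(1) by auto
    have "distinct (map fst (map r xs))"
      using xs(2,3) assms(4) unfolding eq distinct_map[of \<pi>] by (simp add: bij_betw_def)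
    moreover have "set (map fst (map r xs)) = {1..n}"
      unfolding eq set_map xs(3) using assms(4) by (simp add: bij_betw_def)
    then have "fst ` set (map r xs) = {1..n}" by (simp only: set_map)
    moreover have "set (map r xs) \<subseteq> B" using xs(1) assms(2) by auto
    ultimately have "Word (map r xs) \<in> multilinear_words n B"
      unfolding multilinear_words_def by (intro imageI CollectI conjI)
    then show ?thesis using w by simp
  qed
  then have "Poly_Mapping.single (map_word r w) 1 \<in> coord_space (multilinear_words n B)"
    if "w \<in> Poly_Mapping.keys p" for w
    using assms(1) that by (auto simp: coord_space_def)
  then show ?thesis unfolding sub_letters_def lin_ext_def
    by (intro free_vs.subspace_sum free_vs.subspace_scale subspace_coord_space)
qed

definition value_at ::
  "((('f::field, 'k::{finite,linorder}) mat \<Rightarrow> ('f, 'k) mat) \<Rightarrow> 'a \<Rightarrow> 'a) \<Rightarrow> (nat \<Rightarrow> 'a) \<Rightarrow> ('f, 'k) symb \<Rightarrow> 'a" where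
  "value_at act \<alpha> = (\<lambda>(i, a, b). act (elem_map a b) (\<alpha> i))"

text \<open>
  A multilinear polynomial of positive degree lies in the nonunital free algebra anyway, so that
  being an identity is a matter of evaluation only.
\<close>

lemma Id_U_iff:
  fixes f :: "('f::field, 'k::{finite,linorder}) symb word \<Rightarrow>\<^sub>0 'f" and scl :: "'f \<Rightarrow> 'a \<Rightarrow> 'a::ring"
  assumes f: "f \<in> coord_space (multilinear_words n ({1..n} \<times> exponents))" and n: "n \<ge> 1"
  shows "f \<in> Id_U scl act \<longleftrightarrow> (\<forall>\<alpha>. eval_free scl (value_at act \<alpha>) f = 0)"
proof -
  have sub: "{1..n} \<times> exponents \<subseteq> (symbols :: ('f, 'k) symb set)"
    unfolding symbols_def by (intro Sigma_mono) auto
  have "f \<in> free_alg symbols"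
  proof (rule free_algI)
    fix w assume "w \<in> Poly_Mapping.keys f"
    then have "w \<in> multilinear_words n ({1..n} \<times> exponents)" using f by (auto simp: coord_space_def)
    then have "set (letters w) \<subseteq> {1..n} \<times> exponents"
      by (auto simp: multilinear_words_def)
    with sub show "set (letters w) \<subseteq> symbols" by (rule subset_trans[rotated])
  qed
  moreover have "0 \<notin> multilinear_words n A" for A :: "('f, 'k) symb set"
    using n by (auto simp: multilinear_words_def zero_word_def)
  then have "Poly_Mapping.lookup f 0 = 0"
    using f by (auto simp: coord_space_def in_keys_iff)
  ultimately show ?thesis by (simp add: Id_U_def free_alg_nonunital_def value_at_def)
qed

lemma subspace_multilinear_Id_U:
  fixes scl :: "'f::field \<Rightarrow> 'a \<Rightarrow> 'a::ring"
    and act :: "(('f, 'k::{finite,linorder}) mat \<Rightarrow> ('f, 'k) mat) \<Rightarrow> 'a \<Rightarrow> 'a"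
  assumes "vector_space scl" "n \<ge> 1"
  shows "free_vs.subspace (coord_space (multilinear_words n ({1..n} \<times> exponents)) \<inter> Id_U scl act)"
proof -
  interpret vector_space scl by fact
  let ?V = "coord_space (multilinear_words n ({1..n} \<times> exponents)) :: (('f, 'k) symb word \<Rightarrow>\<^sub>0 'f) set"
  let ?Z = "{p :: ('f, 'k) symb word \<Rightarrow>\<^sub>0 'f. \<forall>\<alpha>. eval_free scl (value_at act \<alpha>) p = 0}"
  have eq: "?V \<inter> Id_U scl act = ?V \<inter> ?Z"
    using Id_U_iff[OF _ assms(2)] by blast
  have "eval_free scl \<rho> 0 = 0" for \<rho> :: "('f, 'k) symb \<Rightarrow> 'a"
    by (simp add: eval_free_def)
  then have "free_vs.subspace ?Z"
    unfolding free_vs.subspace_def by (simp add: eval_free_eq_lin_ext lin_ext_add lin_ext_fscale)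
  then show ?thesis
    unfolding eq by (rule free_vs.subspace_inter[OF subspace_coord_space])
qed

section \<open>The isomorphism between the components\<close>

text \<open>
  The renaming of letters behind the isomorphism: variables move along \<open>\<pi>\<close>, and the source \<open>a\<close>
  of an exponent \<open>(a, b)\<close> is replaced by the one prescribed for the new variable. The target \<open>b\<close>
  remains.
\<close>

definition recolour ::
  "nat set \<Rightarrow> (nat \<Rightarrow> nat) \<Rightarrow> (nat \<Rightarrow> ('f::field, 'k::{finite,linorder}) mat) \<Rightarrow> ('f, 'k) symb \<Rightarrow> ('f, 'k) symb" where
  "recolour I \<pi> a' = (\<lambda>(i, a, b). (\<pi> i, if i \<in> I then g_mat else a' (\<pi> i), b))"

text \<open>
  Identities go to identities because evaluating the renamed polynomial at \<open>\<alpha>\<close> is evaluating the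
  original one at other elements: for an old source \<open>a\<close> and a new source \<open>c\<close>,
  \<open>\<phi>\<^sub>c\<^sub>b = \<phi>\<^sub>a\<^sub>b \<circ> \<phi>\<^sub>c\<^sub>a\<close>, so the value of the renamed letter with
  exponent \<open>(c, b)\<close> is the value of the old letter with exponent \<open>(a, b)\<close> after the element
  \<open>\<alpha>\<close> has been replaced by its image under \<open>\<phi>\<^sub>c\<^sub>a\<close>.
\<close>

lemma sub_letters_recolour:
  fixes act :: "(('f::field_char_0, 'k::{finite,linorder}) mat \<Rightarrow> ('f, 'k) mat) \<Rightarrow> 'a::ring \<Rightarrow> 'a"
  assumes LU: "LU_algebra scl \<delta> act" and n: "n \<ge> 1"
    and IJ: "I \<inter> J = {}" "I \<union> J = {1..n}" and IJ': "I' \<inter> J' = {}" "I' \<union> J' = {1..n}"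
    and \<pi>: "bij_betw \<pi> I I'" "bij_betw \<pi> J J'"
    and a: "\<And>j. j \<in> J \<Longrightarrow> a j \<in> S_basis" and a': "\<And>j. j \<in> J' \<Longrightarrow> a' j \<in> S_basis"
    and p: "p \<in> coord_space (multilinear_words n (split_letters I J a))"
  shows "sub_letters (recolour I \<pi> a') p \<in> coord_space (multilinear_words n (split_letters I' J' a'))"
    and "p \<in> Id_U scl act \<Longrightarrow> sub_letters (recolour I \<pi> a') p \<in> Id_U scl act"
proof -
  interpret LU_algebra scl \<delta> act by fact
  let ?q = "sub_letters (recolour I \<pi> a') p"
  have \<pi>_mem: "\<pi> i \<in> I'" if "i \<in> I" for i using \<pi>(1) that by (auto simp: bij_betw_def)
  have \<pi>_mem': "\<pi> i \<in> J'" if "i \<in> J" for i using \<pi>(2) that by (auto simp: bij_betw_def)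
  have \<pi>_bij: "bij_betw \<pi> {1..n} {1..n}"
    using bij_betw_combine[OF \<pi> IJ'(1)] by (simp only: IJ(2) IJ'(2))
  show q: "?q \<in> coord_space (multilinear_words n (split_letters I' J' a'))"
  proof (rule sub_letters_coord_space[OF p _ _ \<pi>_bij])
    show "recolour I \<pi> a' x \<in> split_letters I' J' a'" if "x \<in> split_letters I J a" for x
    proof -
      have "i \<notin> I" if "i \<in> J" for i using that IJ(1) by blast
      then show ?thesis
        using that \<pi>_mem \<pi>_mem' unfolding split_letters_def recolour_def by auto
    qed
  qed (auto simp: recolour_def)
  have sub: "coord_space (multilinear_words n (split_letters I J a)) \<subseteq>
      coord_space (multilinear_words n ({1..n} \<times> exponents))"
    using multilinear_words_mono[OF split_letters_subset[of J a I], of n] a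
    by (auto simp: IJ(2) coord_space_def)
  have sub': "coord_space (multilinear_words n (split_letters I' J' a')) \<subseteq>
      coord_space (multilinear_words n ({1..n} \<times> exponents))"
    using multilinear_words_mono[OF split_letters_subset[of J' a' I'], of n] a'
    by (auto simp: IJ'(2) coord_space_def)
  assume pId: "p \<in> Id_U scl act"
  have "eval_free scl (value_at act \<alpha>) ?q = 0" for \<alpha>
  proof -
    define \<beta> where "\<beta> i = (if i \<in> I then \<alpha> (\<pi> i) else act (elem_map (a' (\<pi> i)) (a i)) (\<alpha> (\<pi> i)))" for i
    have val: "value_at act \<alpha> (recolour I \<pi> a' x) = value_at act \<beta> x" if x: "x \<in> split_letters I J a" for x
    proof -
      consider i where "x = (i, g_mat, g_mat)" "i \<in> I" |
          j b where "x = (j, a j, b)" "j \<in> J" "b \<in> S_basis"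
        using x by (auto simp: split_letters_def)
      then show ?thesis
      proof cases
        case 2
        then have "j \<notin> I" using IJ(1) by blast
        moreover have "a j \<in> S_basis" "a' (\<pi> j) \<in> S_basis" using 2 a a' \<pi>_mem' by auto
        ultimately show ?thesis using 2
          by (simp add: value_at_def recolour_def \<beta>_def act_elem_map_comp[OF LU] exponents_def)
      qed (simp add: value_at_def recolour_def \<beta>_def)
    qed
    have "eval_free scl (value_at act \<alpha>) ?q = eval_free scl (\<lambda>x. value_at act \<alpha> (recolour I \<pi> a' x)) p"
      by (rule eval_sub_letters[OF vector_space_axioms])
    also have "\<dots> = eval_free scl (value_at act \<beta>) p"
      unfolding eval_free_eq_lin_ext
    proof (intro lin_ext_cong eval_word_cong val)
      fix w x assume "w \<in> Poly_Mapping.keys p" "x \<in> set (letters w)"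
      then show "x \<in> split_letters I J a" by (rule letters_in_coord_space[OF p])
    qed
    also have "\<dots> = 0" using Id_U_iff[OF subsetD[OF sub p] n] pId by blast
    finally show ?thesis .
  qed
  then show "?q \<in> Id_U scl act" using Id_U_iff[OF subsetD[OF sub' q] n] by blast
qed

lemma recolour_inverse:
  assumes "x \<in> split_letters I J a" "I \<inter> J = {}" "I' \<inter> J' = {}"
    and \<pi>: "bij_betw \<pi> I I'" "bij_betw \<pi> J J'" and \<psi>: "\<And>i. i \<in> I \<union> J \<Longrightarrow> \<psi> (\<pi> i) = i"
  shows "recolour I' \<psi> a (recolour I \<pi> a' x) = x"
proof -
  consider i where "x = (i, g_mat, g_mat)" "i \<in> I" "\<pi> i \<in> I'" |
      j b where "x = (j, a j, b)" "j \<in> J" "\<pi> j \<in> J'"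
    using assms(1) bij_betwE[OF \<pi>(1)] bij_betwE[OF \<pi>(2)] by (auto simp: split_letters_def)
  then show ?thesis
    using assms(2,3) \<psi> by cases (auto simp: recolour_def)
qed

text \<open>
  The inverse is again a renaming of letters, along the inverse bijection, so identities are
  preserved in both directions.
\<close>

lemma component_iso:
  fixes act :: "(('f::field_char_0, 'k::{finite,linorder}) mat \<Rightarrow> ('f, 'k) mat) \<Rightarrow> 'a::ring \<Rightarrow> 'a"
  assumes LU: "LU_algebra scl \<delta> act" and n: "n \<ge> 1"
    and IJ: "I \<inter> J = {}" "I \<union> J = {1..n}" and IJ': "I' \<inter> J' = {}" "I' \<union> J' = {1..n}"
    and card: "card I = card I'"
    and a: "\<And>j. j \<in> J \<Longrightarrow> a j \<in> S_basis" and a': "\<And>j. j \<in> J' \<Longrightarrow> a' j \<in> S_basis"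
  obtains T where "Vector_Spaces.linear fscale fscale T"
    "bij_betw T (P_U_split n I J a) (P_U_split n I' J' a')"
    "T ` (P_U_split n I J a \<inter> Id_U scl act) = P_U_split n I' J' a' \<inter> Id_U scl act"
proof -
  have fin: "finite I" "finite J" "finite I'" "finite J'"
    using IJ(2) IJ'(2) by (metis finite_Un finite_atLeastAtMost)+
  have cardJ: "card J = card J'"
    using card_Un_disjoint[OF fin(1,2) IJ(1)] card_Un_disjoint[OF fin(3,4) IJ'(1)] card IJ(2) IJ'(2)
    by simp
  obtain f where f: "bij_betw f I I'" using finite_same_card_bij[OF fin(1,3) card] by blast
  obtain h where h: "bij_betw h J J'" using finite_same_card_bij[OF fin(2,4) cardJ] by blast
  define \<pi> where "\<pi> i = (if i \<in> I then f i else h i)" for i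
  have \<pi>: "bij_betw \<pi> I I'" "bij_betw \<pi> J J'"
  proof -
    have "\<pi> j = h j" if "j \<in> J" for j using that IJ(1) by (auto simp: \<pi>_def)
    then show "bij_betw \<pi> J J'" using h by (simp cong: bij_betw_cong)
    show "bij_betw \<pi> I I'" using f by (simp add: \<pi>_def cong: bij_betw_cong)
  qed
  have \<pi>_bij: "bij_betw \<pi> (I \<union> J) (I' \<union> J')" using bij_betw_combine[OF \<pi> IJ'(1)] .
  define \<psi> where "\<psi> = inv_into (I \<union> J) \<pi>"
  have \<psi>\<pi>: "\<psi> (\<pi> i) = i" if "i \<in> I \<union> J" for i
    using that \<pi>_bij by (auto simp: \<psi>_def bij_betw_def intro: inv_into_f_f)
  have \<pi>\<psi>: "\<pi> (\<psi> i) = i" if "i \<in> I' \<union> J'" for i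
    using that \<pi>_bij by (auto simp: \<psi>_def bij_betw_def intro!: f_inv_into_f)
  have \<psi>: "bij_betw \<psi> I' I" "bij_betw \<psi> J' J"
    using bij_betw_imp_surj_on[OF \<pi>(1)] bij_betw_imp_surj_on[OF \<pi>(2)] \<psi>\<pi> \<pi>\<psi>
    by (intro bij_betw_byWitness[where f' = \<pi>]; force)+
  let ?T = "sub_letters (recolour I \<pi> a') :: (('f, 'k) symb word \<Rightarrow>\<^sub>0 'f) \<Rightarrow> _"
  let ?T' = "sub_letters (recolour I' \<psi> a) :: (('f, 'k) symb word \<Rightarrow>\<^sub>0 'f) \<Rightarrow> _"
  let ?V = "P_U_split n I J a" and ?V' = "P_U_split n I' J' a'"
  note V = P_U_split_eq[OF IJ, of a] and V' = P_U_split_eq[OF IJ', of a']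
  have T: "?T p \<in> ?V'" "p \<in> Id_U scl act \<Longrightarrow> ?T p \<in> Id_U scl act" if "p \<in> ?V" for p
    using sub_letters_recolour[OF LU n IJ IJ' \<pi>, of a a' p] a a' that unfolding V V' by auto
  have T': "?T' p \<in> ?V" "p \<in> Id_U scl act \<Longrightarrow> ?T' p \<in> Id_U scl act" if "p \<in> ?V'" for p
    using sub_letters_recolour[OF LU n IJ' IJ \<psi>, of a' a p] a a' that unfolding V V' by auto
  have inv: "?T' (?T p) = p" if "p \<in> ?V" for p
  proof (rule sub_letters_inverse)
    fix w x assume "w \<in> Poly_Mapping.keys p" "x \<in> set (letters w)"
    then have "x \<in> split_letters I J a" by (rule letters_in_coord_space[OF that[unfolded V]])
    then show "recolour I' \<psi> a (recolour I \<pi> a' x) = x"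
      using IJ(1) IJ'(1) \<pi> \<psi>\<pi> by (rule recolour_inverse)
  qed
  have inv': "?T (?T' p) = p" if "p \<in> ?V'" for p
  proof (rule sub_letters_inverse)
    fix w x assume "w \<in> Poly_Mapping.keys p" "x \<in> set (letters w)"
    then have "x \<in> split_letters I' J' a'" by (rule letters_in_coord_space[OF that[unfolded V']])
    then show "recolour I \<pi> a' (recolour I' \<psi> a x) = x"
      using IJ'(1) IJ(1) \<psi> \<pi>\<psi> by (rule recolour_inverse)
  qed
  show ?thesis
  proof
    show "Vector_Spaces.linear fscale fscale ?T"
      unfolding sub_letters_def by (rule free_vs.linear_lin_ext)
    show "bij_betw ?T ?V ?V'"
      using inv inv' T(1) T'(1) by (intro bij_betw_byWitness[where f' = ?T']) auto
    show "?T ` (?V \<inter> Id_U scl act) = ?V' \<inter> Id_U scl act"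
    proof
      show "?T ` (?V \<inter> Id_U scl act) \<subseteq> ?V' \<inter> Id_U scl act" using T by blast
      show "?V' \<inter> Id_U scl act \<subseteq> ?T ` (?V \<inter> Id_U scl act)"
      proof
        fix p assume "p \<in> ?V' \<inter> Id_U scl act"
        then show "p \<in> ?T ` (?V \<inter> Id_U scl act)"
          using T' inv' by (intro image_eqI[of _ _ "?T' p"]) auto
      qed
    qed
  qed
qed

section \<open>Decomposition of the multilinear space\<close>

text \<open>
  Functions restricted to the complement of \<open>I\<close>, so that each component has exactly one index
  and the indices can be counted.
\<close>

definition components :: "nat \<Rightarrow> (nat set \<times> (nat \<Rightarrow> ('f::field, 'k::{finite,linorder}) mat)) set" where
  "components n = (SIGMA I:Pow {1..n}. {1..n} - I \<rightarrow>\<^sub>E S_basis)"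

definition component_words ::
  "nat \<Rightarrow> nat set \<times> (nat \<Rightarrow> ('f::field, 'k::{finite,linorder}) mat) \<Rightarrow> ('f, 'k) symb word set" where
  "component_words n t = multilinear_words n (split_letters (fst t) ({1..n} - fst t) (snd t))"

lemma finite_components: "finite (components n)"
  unfolding components_def by (intro finite_SigmaI finite_PiE) (auto simp: finite_S_basis)

lemma component_letters_subset:
  assumes "t \<in> components n"
  shows "split_letters (fst t) ({1..n} - fst t) (snd t) \<subseteq> {1..n} \<times> exponents"
proof -
  have "fst t \<union> ({1..n} - fst t) = {1..n}" using assms by (auto simp: components_def)
  moreover have "snd t j \<in> S_basis" if "j \<in> {1..n} - fst t" for j
    using assms that by (auto simp: components_def)
  ultimately show ?thesis using split_letters_subset[of "{1..n} - fst t" "snd t" "fst t"] by simp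
qed

text \<open>
  A multilinear word determines its component: each variable occurs once, and the source of its
  exponent tells whether the variable belongs to \<open>I\<close> and otherwise what \<open>a\<close> is there.
\<close>

lemma UN_component_words:
  fixes n :: nat
  shows "(\<Union>t\<in>components n. component_words n t) =
    (multilinear_words n ({1..n} \<times> exponents) :: ('f::field, 'k::{finite,linorder}) symb word set)"
proof
  show "(\<Union>t\<in>components n. component_words n t) \<subseteq>
      (multilinear_words n ({1..n} \<times> exponents) :: ('f, 'k) symb word set)"
    unfolding component_words_def
    by (intro UN_least multilinear_words_mono component_letters_subset)
  show "(multilinear_words n ({1..n} \<times> exponents) :: ('f, 'k) symb word set) \<subseteq>
      (\<Union>t\<in>components n. component_words n t)"
  proof
    fix w :: "('f, 'k) symb word"
    assume "w \<in> multilinear_words n ({1..n} \<times> exponents)"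
    then obtain xs where w: "w = Word xs" and xs: "set xs \<subseteq> {1..n} \<times> exponents"
        "distinct (map fst xs)" "fst ` set xs = {1..n}"
      by (auto simp: multilinear_words_def)
    define e where "e i = the (map_of xs i)" for i
    have e: "e i = x" if "(i, x) \<in> set xs" for i x
      using map_of_is_SomeI[OF xs(2) that] by (simp add: e_def)
    have mem: "(i, e i) \<in> set xs" if i: "i \<in> {1..n}" for i
    proof -
      obtain x where "(i, x) \<in> set xs" using i xs(3) by force
      then show ?thesis using e by simp
    qed
    define I where "I = {i \<in> {1..n}. e i = (g_mat, g_mat)}"
    define a where "a = restrict (\<lambda>j. fst (e j)) ({1..n} - I)"
    have off: "e j \<in> S_basis \<times> S_basis" if "j \<in> {1..n} - I" for j
      using mem[of j] that xs(1) by (auto simp: I_def exponents_def)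
    have "(I, a) \<in> components n"
      using off by (fastforce simp: components_def I_def a_def mem_Times_iff)
    moreover have "set xs \<subseteq> split_letters I ({1..n} - I) a"
    proof
      fix x assume x: "x \<in> set xs"
      obtain i y where iy: "x = (i, y)" by (cases x)
      have i: "i \<in> {1..n}" "y = e i" using x xs(3) e[of i y] iy by force+
      show "x \<in> split_letters I ({1..n} - I) a"
      proof (cases "i \<in> I")
        case True
        then show ?thesis using i iy by (auto simp: split_letters_def I_def)
      next
        case False
        then have "e i \<in> S_basis \<times> S_basis" "a i = fst (e i)" using off[of i] i by (auto simp: a_def)
        then show ?thesis using i False by (auto simp: iy split_letters_def mem_Times_iff intro!: prod_eqI)
      qed
    qed
    then have "w \<in> component_words n (I, a)"
      using w xs(2,3) by (auto simp: component_words_def multilinear_words_def)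
    ultimately show "w \<in> (\<Union>t\<in>components n. component_words n t)" by blast
  qed
qed

lemma disjoint_component_words:
  "disjoint_family_on (component_words n)
    (components n :: (nat set \<times> (nat \<Rightarrow> ('f::field_char_0, 'k::{finite,linorder}) mat)) set)"
  unfolding disjoint_family_on_def
proof (intro ballI impI)
  fix s t :: "nat set \<times> (nat \<Rightarrow> ('f, 'k) mat)"
  assume st: "s \<in> components n" "t \<in> components n" "s \<noteq> t"
  obtain I a I' a' where s: "s = (I, a)" and t: "t = (I', a')" by (cases s, cases t)
  show "component_words n s \<inter> component_words n t = {}"
  proof (rule ccontr)
    assume "component_words n s \<inter> component_words n t \<noteq> {}"
    then obtain xs where xs: "set xs \<subseteq> split_letters I ({1..n} - I) a"
        "set xs \<subseteq> split_letters I' ({1..n} - I') a'" "fst ` set xs = {1..n}"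
      by (auto simp: component_words_def multilinear_words_def s t)
    have IJ: "I \<subseteq> {1..n}" "I' \<subseteq> {1..n}" and a: "a \<in> {1..n} - I \<rightarrow>\<^sub>E S_basis" "a' \<in> {1..n} - I' \<rightarrow>\<^sub>E S_basis"
      using st(1,2) by (auto simp: components_def s t)
    have same: "(i \<in> I \<longleftrightarrow> i \<in> I') \<and> (i \<notin> I \<longrightarrow> a i = a' i)" if i: "i \<in> {1..n}" for i
    proof -
      obtain x where x: "(i, x) \<in> set xs" using i xs(3) by force
      have "(i \<in> I \<and> x = (g_mat, g_mat)) \<or> (i \<notin> I \<and> a i = fst x \<and> snd x \<in> S_basis)"
        using subsetD[OF xs(1) x] by (auto simp: split_letters_def)
      moreover have "(i \<in> I' \<and> x = (g_mat, g_mat)) \<or> (i \<notin> I' \<and> a' i = fst x \<and> snd x \<in> S_basis)"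
        using subsetD[OF xs(2) x] by (auto simp: split_letters_def)
      ultimately show ?thesis using g_mat_notin_S_basis[where 'f = 'f and 'k = 'k] by auto
    qed
    have I: "I = I'" using IJ same by blast
    moreover have "a = a'"
      using same I by (intro PiE_ext[OF a(1)]) (use a(2) in auto)
    ultimately show False using st(3) s t by simp
  qed
qed

text \<open>
  Projection to a component is a substitution: replacing the element \<open>\<alpha>\<^sub>i\<close> by its image under the
  idempotent \<open>\<phi>\<^sub>b\<^sub>b\<close>, where \<open>b\<close> is the source prescribed for the variable \<open>i\<close>, fixes the values
  of the letters that belong to the component and annihilates those of all others.
\<close>

lemma coord_proj_Id_U:
  fixes act :: "(('f::field_char_0, 'k::{finite,linorder}) mat \<Rightarrow> ('f, 'k) mat) \<Rightarrow> 'a::ring \<Rightarrow> 'a"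
  assumes LU: "LU_algebra scl \<delta> act" and n: "n \<ge> 1" and t: "t \<in> components n"
    and p: "p \<in> coord_space (multilinear_words n ({1..n} \<times> exponents))" "p \<in> Id_U scl act"
  shows "coord_proj (component_words n t) p \<in> Id_U scl act"
proof -
  interpret LU_algebra scl \<delta> act by fact
  obtain I a where Ia: "t = (I, a)" by (cases t)
  have I: "I \<subseteq> {1..n}" and a: "\<And>j. j \<in> {1..n} - I \<Longrightarrow> a j \<in> S_basis"
    using t by (auto simp: components_def Ia)
  let ?K = "component_words n t" and ?A = "split_letters I ({1..n} - I) a"
  have sub: "?A \<subseteq> {1..n} \<times> exponents" using component_letters_subset[OF t] by (simp add: Ia)
  have "eval_free scl (value_at act \<alpha>) (coord_proj ?K p) = 0" for \<alpha>
  proof -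
    \<comment> \<open>the source of the exponent that the component prescribes for the variable \<open>i\<close>\<close>
    define b where "b i = (if i \<in> I then g_mat else a i)" for i
    define \<beta> where "\<beta> i = act (elem_map (b i) (b i)) (\<alpha> i)" for i
    have b: "(b i, b i) \<in> exponents" if "i \<in> {1..n}" for i
      using that a by (auto simp: b_def exponents_def)
    have val: "value_at act \<beta> (i, c, d) = (if c = b i then value_at act \<alpha> (i, c, d) else 0)"
      if "(i, c, d) \<in> {1..n} \<times> exponents" for i c d
      using that b[of i] by (auto simp: value_at_def \<beta>_def act_elem_map_comp[OF LU])
    have A_iff: "(i, c, d) \<in> ?A \<longleftrightarrow> c = b i" if "(i, c, d) \<in> {1..n} \<times> exponents" for i c d
      using that a[of i] g_mat_notin_S_basis[where 'f = 'f and 'k = 'k]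
      by (auto simp: split_letters_def b_def exponents_def)
    have word: "eval_word (value_at act \<beta>) (letters w) =
        (if w \<in> ?K then eval_word (value_at act \<alpha>) (letters w) else 0)" if "w \<in> Poly_Mapping.keys p" for w
    proof -
      have "w \<in> multilinear_words n ({1..n} \<times> exponents)" using p(1) that by (auto simp: coord_space_def)
      then obtain xs where w: "w = Word xs" and xs: "set xs \<subseteq> {1..n} \<times> exponents"
          "distinct (map fst xs)" "fst ` set xs = {1..n}"
        by (auto simp: multilinear_words_def)
      have K: "w \<in> ?K \<longleftrightarrow> set xs \<subseteq> ?A"
        using xs(2,3) by (auto simp: component_words_def multilinear_words_def Ia w)
      show ?thesis
      proof (cases "w \<in> ?K")
        case True
        have "value_at act \<beta> x = value_at act \<alpha> x" if "x \<in> set xs" for x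
        proof -
          obtain i c d where x: "x = (i, c, d)" by (cases x)
          then have mem: "(i, c, d) \<in> {1..n} \<times> exponents" "(i, c, d) \<in> ?A"
            using True that xs(1) unfolding K by blast+
          then show ?thesis using val[OF mem(1)] A_iff[OF mem(1)] unfolding x by simp
        qed
        then show ?thesis
          using True w eval_word_cong[of xs "value_at act \<beta>" "value_at act \<alpha>"] by simp
      next
        case False
        then obtain x where x: "x \<in> set xs" "x \<notin> ?A" unfolding K by blast
        obtain i c d where icd: "x = (i, c, d)" by (cases x)
        have mem: "(i, c, d) \<in> {1..n} \<times> exponents" using x(1) xs(1) unfolding icd by blast
        have "value_at act \<beta> x = 0"
          using val[OF mem] A_iff[OF mem] x(2) unfolding icd by simp
        then show ?thesis using False w eval_word_zero[OF x(1)] by simp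
      qed
    qed
    have "eval_free scl (value_at act \<alpha>) (coord_proj ?K p) =
        lin_ext scl (\<lambda>w. if w \<in> ?K then eval_word (value_at act \<alpha>) (letters w) else 0) p"
      unfolding eval_free_eq_lin_ext coord_proj_def lin_ext_lin_ext
      by (intro lin_ext_cong) (simp add: lin_ext_single, simp add: lin_ext_def)
    also have "\<dots> = eval_free scl (value_at act \<beta>) p"
      unfolding eval_free_eq_lin_ext by (intro lin_ext_cong) (simp add: word)
    also have "\<dots> = 0" using Id_U_iff[OF p(1) n] p(2) by blast
    finally show ?thesis .
  qed
  moreover have "coord_proj ?K p \<in> coord_space (multilinear_words n ({1..n} \<times> exponents))"
    using coord_proj_in_coord_space[of ?K p] multilinear_words_mono[OF component_letters_subset[OF t]]
    unfolding coord_space_def component_words_def by blast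
  ultimately show ?thesis using Id_U_iff[OF _ n] by blast
qed

section \<open>Codimensions\<close>

lemma quotient_dim_component:
  fixes act :: "(('f::field_char_0, 'k::{finite,linorder}) mat \<Rightarrow> ('f, 'k) mat) \<Rightarrow> 'a::ring \<Rightarrow> 'a"
  assumes LU: "LU_algebra scl \<delta> act" and n: "n \<ge> 1" and t: "t \<in> components n" and c: "c \<in> S_basis"
  shows "quotient_dim (coord_space (component_words n t)) (coord_space (component_words n t) \<inter> Id_U scl act) =
    codim_U_std scl act n (card (fst t)) c"
proof -
  interpret LU_algebra scl \<delta> act by fact
  obtain I a where Ia: "t = (I, a)" by (cases t)
  have I: "I \<subseteq> {1..n}" and a: "\<And>j. j \<in> {1..n} - I \<Longrightarrow> a j \<in> S_basis"
    using t by (auto simp: components_def Ia)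
  let ?J = "{1..n} - I" and ?I' = "{1..card I}" and ?J' = "{card I + 1..n}"
  have IJ: "I \<inter> ?J = {}" "I \<union> ?J = {1..n}" using I by auto
  have "card I \<le> n" using card_mono[OF _ I] by simp
  then have IJ': "?I' \<inter> ?J' = {}" "?I' \<union> ?J' = {1..n}" by auto
  let ?K = "component_words n t"
  let ?K' = "multilinear_words n (split_letters ?I' ?J' (\<lambda>_. c))"
  note V = P_U_split_eq[OF IJ, of a] and V' = P_U_split_eq[OF IJ', of "\<lambda>_. c"]
  have K: "?K = multilinear_words n (split_letters I ?J a)" by (simp add: component_words_def Ia)
  obtain T where T: "Vector_Spaces.linear fscale fscale T"
    "bij_betw T (P_U_split n I ?J a) (P_U_split n ?I' ?J' (\<lambda>_. c))"
    "T ` (P_U_split n I ?J a \<inter> Id_U scl act) = P_U_split n ?I' ?J' (\<lambda>_. c) \<inter> Id_U scl act"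
    by (rule component_iso[OF LU n IJ IJ', of a "\<lambda>_. c"]) (use a c in auto)
  note T = T[unfolded V V', folded K]
  have A: "split_letters I ?J a \<subseteq> {1..n} \<times> exponents" "split_letters ?I' ?J' (\<lambda>_. c) \<subseteq> {1..n} \<times> exponents"
    using split_letters_subset[of ?J a I] split_letters_subset[of ?J' "\<lambda>_. c" ?I'] a c IJ(2) IJ'(2) by auto
  have sub: "coord_space ?K \<subseteq> (coord_space (multilinear_words n ({1..n} \<times> exponents)) :: (('f, 'k) symb word \<Rightarrow>\<^sub>0 'f) set)"
    using multilinear_words_mono[OF A(1)] unfolding K coord_space_def by blast
  have fin: "finite (multilinear_words n B)" if "B \<subseteq> {1..n} \<times> exponents" for B :: "('f, 'k) symb set"
    by (intro finite_multilinear_words finite_subset[OF that]) (simp add: finite_exponents)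
  have W: "free_vs.subspace (coord_space ?K \<inter> Id_U scl act)"
  proof -
    have "coord_space ?K \<inter> Id_U scl act =
        coord_space ?K \<inter> (coord_space (multilinear_words n ({1..n} \<times> exponents)) \<inter> Id_U scl act)"
      using sub by blast
    then show ?thesis
      using free_vs.subspace_inter[OF subspace_coord_space subspace_multilinear_Id_U[OF vector_space_axioms n]]
      by simp
  qed
  have "quotient_dim (coord_space ?K) (coord_space ?K \<inter> Id_U scl act) =
      quotient_dim (coord_space ?K') (coord_space ?K' \<inter> Id_U scl act)"
    by (rule quotient_dim_injective_image[OF T(1) bij_betw_imp_inj_on[OF T(2)] bij_betw_imp_surj_on[OF T(2)] T(3) W])
      (use fin A in \<open>auto simp: K\<close>)
  then show ?thesis unfolding codim_U_std_def P_U_std_def Ia fst_conv V' by simp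
qed

lemma codim_U_eq_sum:
  fixes act :: "(('f::field_char_0, 'k::{finite,linorder}) mat \<Rightarrow> ('f, 'k) mat) \<Rightarrow> 'a::ring \<Rightarrow> 'a"
  assumes LU: "LU_algebra scl \<delta> act" and n: "n \<ge> 1" and c: "c \<in> S_basis"
  shows "codim_U scl act n =
    (\<Sum>r\<le>n. (n choose r) * (CARD('k)\<^sup>2 - 1) ^ (n - r) * codim_U_std scl act n r c)"
proof -
  interpret LU_algebra scl \<delta> act by fact
  let ?N = "multilinear_words n ({1..n} \<times> exponents) :: ('f, 'k) symb word set"
  let ?T = "components n :: (nat set \<times> (nat \<Rightarrow> ('f, 'k) mat)) set"
  let ?W = "coord_space ?N \<inter> Id_U scl act"
  let ?q = "\<lambda>r. codim_U_std scl act n r c" and ?m = "CARD('k)\<^sup>2 - 1"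
  have sub: "coord_space (component_words n t) \<subseteq> (coord_space ?N :: (('f, 'k) symb word \<Rightarrow>\<^sub>0 'f) set)"
    if "t \<in> ?T" for t
    using that UN_component_words[of n, where 'f = 'f and 'k = 'k] unfolding coord_space_def by blast
  have "codim_U scl act n = quotient_dim (coord_space (\<Union>t\<in>?T. component_words n t)) ?W"
    by (simp only: codim_U_def P_U_eq UN_component_words)
  also have "\<dots> = (\<Sum>t\<in>?T. quotient_dim (coord_space (component_words n t)) (coord_space (component_words n t) \<inter> ?W))"
  proof (rule quotient_dim_eq_sum[OF finite_components disjoint_component_words])
    show "finite (component_words n t)" if "t \<in> ?T" for t
      unfolding component_words_def
      by (intro finite_multilinear_words finite_subset[OF component_letters_subset[OF that]])
        (simp add: finite_exponents)
    show "free_vs.subspace ?W" by (rule subspace_multilinear_Id_U[OF vector_space_axioms n])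
    show "?W \<subseteq> coord_space (\<Union>t\<in>?T. component_words n t)" unfolding UN_component_words by blast
    show "coord_proj (component_words n t) p \<in> ?W" if "p \<in> ?W" "t \<in> ?T" for p t
      using that coord_proj_Id_U[OF LU n that(2)] sub[OF that(2)] coord_proj_in_coord_space by blast
  qed
  also have "\<dots> = (\<Sum>t\<in>?T. ?q (card (fst t)))"
  proof (rule sum.cong[OF refl])
    fix t assume t: "t \<in> ?T"
    have "coord_space (component_words n t) \<inter> ?W = coord_space (component_words n t) \<inter> Id_U scl act"
      using sub[OF t] by blast
    then show "quotient_dim (coord_space (component_words n t)) (coord_space (component_words n t) \<inter> ?W) =
        ?q (card (fst t))"
      using quotient_dim_component[OF LU n t c] by (simp only:)
  qed
  also have "\<dots> = (\<Sum>I\<in>Pow {1..n}. \<Sum>a\<in>({1..n} - I \<rightarrow>\<^sub>E (S_basis :: ('f, 'k) mat set)). ?q (card I))"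
    unfolding components_def
    by (subst sum.Sigma) (auto intro!: finite_PiE simp: finite_S_basis case_prod_unfold)
  also have "\<dots> = (\<Sum>I\<in>Pow {1..n}. ?m ^ (n - card I) * ?q (card I))"
  proof (rule sum.cong[OF refl])
    fix I assume "I \<in> Pow {1..n}"
    then have "card ({1..n} - I) = n - card I" by (simp add: card_Diff_subset finite_subset)
    then show "(\<Sum>a\<in>({1..n} - I \<rightarrow>\<^sub>E (S_basis :: ('f, 'k) mat set)). ?q (card I)) = ?m ^ (n - card I) * ?q (card I)"
      by (simp add: card_PiE card_S_basis)
  qed
  also have "\<dots> = (\<Sum>r\<le>n. \<Sum>I | I \<in> Pow {1..n} \<and> card I = r. ?m ^ (n - card I) * ?q (card I))"
    by (rule sum.group[symmetric]) (auto dest: card_mono[rotated])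
  also have "\<dots> = (\<Sum>r\<le>n. (n choose r) * ?m ^ (n - r) * ?q r)"
  proof (rule sum.cong[OF refl])
    fix r
    have "card {I. I \<in> Pow {1..n} \<and> card I = r} = n choose r"
      using n_subsets[of "{1..n}" r] by simp
    then show "(\<Sum>I | I \<in> Pow {1..n} \<and> card I = r. ?m ^ (n - card I) * ?q (card I)) =
        (n choose r) * ?m ^ (n - r) * ?q r"
      by (simp add: mult.assoc)
  qed
  finally show ?thesis .
qed

theorem proposition3p5p5:
  fixes scl :: "'f::field_char_0 \<Rightarrow> 'a::ring \<Rightarrow> 'a"
    and \<delta> act :: "(('f, 'k::{finite,linorder}) mat \<Rightarrow> ('f, 'k) mat) \<Rightarrow> 'a \<Rightarrow> 'a"
    and n :: nat
  assumes "CARD('k) \<ge> 2" and "LU_algebra scl \<delta> act" and "n \<ge> 1"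
  shows "(\<forall>I J. \<forall>a :: nat \<Rightarrow> ('f, 'k) mat. \<forall>c.
            I \<inter> J = {} \<and> I \<union> J = {1..n} \<and> (\<forall>j\<in>J. a j \<in> S_basis) \<and> c \<in> S_basis \<longrightarrow>
            (\<exists>T. linear_iso (P_U_split n I J a) (P_U_std n (card I) c) T \<and>
                 T ` (P_U_split n I J a \<inter> Id_U scl act) = P_U_std n (card I) c \<inter> Id_U scl act))
       \<and> (\<forall>c \<in> S_basis. codim_U scl act n =
            (\<Sum>r\<le>n. (n choose r) * (CARD('k)\<^sup>2 - 1) ^ (n - r) * codim_U_std scl act n r c))"
proof (intro conjI allI impI ballI)
  fix I J and a :: "nat \<Rightarrow> ('f, 'k) mat" and c :: "('f, 'k) mat"
  assume *: "I \<inter> J = {} \<and> I \<union> J = {1..n} \<and> (\<forall>j\<in>J. a j \<in> S_basis) \<and> c \<in> S_basis"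
  then have IJ: "I \<inter> J = {}" "I \<union> J = {1..n}" by blast+
  have "card I \<le> n" using card_mono[of "{1..n}" I] IJ(2) by auto
  then have IJ': "{1..card I} \<inter> {card I + 1..n} = {}" "{1..card I} \<union> {card I + 1..n} = {1..n}" by auto
  obtain T where T: "Vector_Spaces.linear fscale fscale T"
    "bij_betw T (P_U_split n I J a) (P_U_std n (card I) c)"
    "T ` (P_U_split n I J a \<inter> Id_U scl act) = P_U_std n (card I) c \<inter> Id_U scl act"
    unfolding P_U_std_def
    by (rule component_iso[OF assms(2,3) IJ IJ', of a "\<lambda>_. c"]) (use * in auto)
  have "linear_iso (P_U_split n I J a) (P_U_std n (card I) c) T"
    using T(1,2) by (simp add: linear_iso_def Vector_Spaces.linear_iff)
  then show "\<exists>T. linear_iso (P_U_split n I J a) (P_U_std n (card I) c) T \<and>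
      T ` (P_U_split n I J a \<inter> Id_U scl act) = P_U_std n (card I) c \<inter> Id_U scl act"
    using T(3) by blast
qed (rule codim_U_eq_sum[OF assms(2,3)])

end
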